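(* Let $G$ be a Halin snark in which all decollineators have been obtained from snarks with circular flow number at least $5$; that is, each decollineator $D_i$ used in the construction of $G$ has the form $D_i=(G_i)_{u_iv_i}$ where $G_i$ is a snark with $\Phi_c(G_i)\ge 5$ and $u_iv_i$ is an edge of $G_i$. Then $\Phi_c(G)\ge 5$.
   Context: Graphs are finite. A snark is a 2-connected cubic graph with no proper 3-edge-colouring. For a real $r\ge 2$, a nowhere-zero real-valued $r$-flow on a graph is an $\mathbb{R}$-flow $\phi$ (with respect to some orientation, at each vertex the sum of incoming values equals the sum of outgoing values) such that $1\le|\phi(e)|\le r-1$ for each edge $e$. The circular flow number $\Phi_c(G)$ is the infimum of all real $r$ such that $G$ has a nowhere-zero real-valued $r$-flow. Multipoles. A multipole consists of vertices and edges; each edge has two ends, each of which may or may not be incident with a vertex; a free end is called a semiedge. All vertices of multipoles considered have degree 3. The junction of two semiedges identifies these free ends, merging their edges into one edge. A $(2,2)$-pole has exactly four semiedges, divided into an input connector and an output connector of size 2 each; a $(2,2;1)$-pole has in addition one residual semiedge. For an edge $uv$ of a cubic graph $G$, $G_{uv}$ is the $(2,2)$-pole obtained by removing the path $uv$ (its vertices and its edge) and keeping as semiedges the remaining edge ends formerly incident with $u$ (input connector) and $v$ (output connector). For a path $uwv$ of length 2, $G_{uwv}$ is the $(2,2;1)$-pole obtained analogously by removing the path $uwv$, with input connector coming from $u$, output connector from $v$, and residual semiedge from $w$; it is called bipartite if $G$ is bipartite. The join $M_1\circ M_2$ is formed by performing junctions of the two semiedges of the output connector of $M_1$ with the two semiedges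 of the input connector of $M_2$ (in either of the two possible ways); its input is that of $M_1$, its output that of $M_2$, and residual semiedges are kept. Decollineators. Let $p_1,\dots,p_4$ be a basis of $\mathbb{F}_2^4$. The tetrahedron $T$ has as points the vectors $p_i$ and $p_i+p_j$ $(i<j)$ and as lines the triples $\{p_i,p_i+p_j,p_j\}$. A $T$-flow on a multipole assigns to each edge a point of $T$ so that at each vertex the three values form a line of $T$. A decollineator is a $(2,2)$-pole that has no $T$-flow for which both the pair of values on the input connector and the pair of values on the output connector consist of two distinct points lying on a common line of $T$ (this does not depend on the choice of $T$). Halin snarks. A Halin fragment is a $(2,2;1)$-pole $F=D\circ B$ where $D$ is a decollineator and $B$ is a bipartite $(2,2;1)$-pole. A cubic Halin graph $H=C\cup S$ consists of a plane tree $S$ all of whose non-leaf vertices have degree 3 (with at least one such vertex) together with a circuit $C=(v_0v_1\cdots v_{k-1})$ passing through all leaves of $S$ so that $H$ is embedded in the plane, with $C$ bounding the outer face. Given Halin fragments $F_i=D_i\circ B_i$, $i=0,\dots,k-1$, a Halin snark is obtained by performing, for each $i$ modulo $k$, junctions of the output connector of $F_i$ with the input connector of $F_{i+1}$ (in either of the two possible ways), adding the tree $S-\{v_0,\dots,v_{k-1}\}$, and attaching the residual semiedge of each $F_i$ to the vertex $v_i'$ that is the neighbour of $v_i$ in $S$. *)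

theory Defs
  imports "HOL-Analysis.Analysis" "HOL-Library.Z2"
begin

section \<open>Multipoles and cubic graphs\<close>

text \<open>
  Multigraphs and multipoles are given by their edge ends. The two ends of an edge are
  exchanged by \<open>mate\<close>; \<open>endv\<close> gives the vertex an end is incident with, and
  \<open>None\<close> marks a free end, i.e. a semiedge. Loops, parallel edges and edges with two free ends
  are possible. Only the values of \<open>mate\<close> and \<open>endv\<close> on \<open>ends\<close> matter.
\<close>

record ('v, 'd) multipole =
  verts :: "'v set"
  ends :: "'d set"
  mate :: "'d \<Rightarrow> 'd"
  endv :: "'d \<Rightarrow> 'v option"

definition edge :: "('v, 'd, 'z) multipole_scheme \<Rightarrow> 'd \<Rightarrow> 'd set" where
  "edge M d = {d, mate M d}"

definition edges :: "('v, 'd, 'z) multipole_scheme \<Rightarrow> 'd set set" where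
  "edges M = edge M ` ends M"

definition ends_at :: "('v, 'd, 'z) multipole_scheme \<Rightarrow> 'v \<Rightarrow> 'd set" where
  "ends_at M v = {d \<in> ends M. endv M d = Some v}"

definition degree :: "('v, 'd, 'z) multipole_scheme \<Rightarrow> 'v \<Rightarrow> nat" where
  "degree M v = card (ends_at M v)"

definition semiedges :: "('v, 'd, 'z) multipole_scheme \<Rightarrow> 'd set" where
  "semiedges M = {d \<in> ends M. endv M d = None}"

definition wf_multipole :: "('v, 'd, 'z) multipole_scheme \<Rightarrow> bool" where
  "wf_multipole M \<longleftrightarrow> finite (verts M) \<and> finite (ends M) \<and>
     (\<forall>d\<in>ends M. mate M d \<in> ends M \<and> mate M d \<noteq> d \<and> mate M (mate M d) = d) \<and>
     (\<forall>d\<in>ends M. \<forall>v. endv M d = Some v \<longrightarrow> v \<in> verts M)"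

definition cubic_multipole :: "('v, 'd, 'z) multipole_scheme \<Rightarrow> bool" where
  "cubic_multipole M \<longleftrightarrow> wf_multipole M \<and> (\<forall>v\<in>verts M. degree M v = 3)"

definition cubic_graph :: "('v, 'd) multipole \<Rightarrow> bool" where
  "cubic_graph G \<longleftrightarrow> cubic_multipole G \<and> semiedges G = {}"

definition adj :: "('v, 'd) multipole \<Rightarrow> 'v rel" where
  "adj G = {(u, v). \<exists>d\<in>ends G. endv G d = Some u \<and> endv G (mate G d) = Some v}"

definition connected_graph :: "('v, 'd) multipole \<Rightarrow> bool" where
  "connected_graph G \<longleftrightarrow> verts G \<noteq> {} \<and> (\<forall>u\<in>verts G. \<forall>v\<in>verts G. (u, v) \<in> (adj G)\<^sup>*)"

definition delete_verts :: "('v, 'd) multipole \<Rightarrow> 'v set \<Rightarrow> ('v, 'd) multipole" where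
  "delete_verts G X = G\<lparr>verts := verts G - X,
     ends := {d \<in> ends G. endv G d \<notin> Some ` X \<and> endv G (mate G d) \<notin> Some ` X}\<rparr>"

definition delete_edges :: "('v, 'd) multipole \<Rightarrow> 'd set set \<Rightarrow> ('v, 'd) multipole" where
  "delete_edges G E = G\<lparr>ends := ends G - \<Union>E\<rparr>"

text \<open>
  As usual for multigraphs, a 2-connected graph has no loop, so that a 2-connected cubic graph
  is bridgeless even if it has only two vertices.
\<close>

definition two_connected :: "('v, 'd) multipole \<Rightarrow> bool" where
  "two_connected G \<longleftrightarrow> 2 \<le> card (verts G) \<and> connected_graph G \<and>
     (\<forall>d\<in>ends G. endv G d \<noteq> endv G (mate G d)) \<and>
     (\<forall>x\<in>verts G. connected_graph (delete_verts G {x}))"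

definition proper_3_edge_colouring :: "('v, 'd) multipole \<Rightarrow> ('d set \<Rightarrow> nat) \<Rightarrow> bool" where
  "proper_3_edge_colouring G c \<longleftrightarrow> (\<forall>e\<in>edges G. c e < 3) \<and>
     (\<forall>v\<in>verts G. inj_on (\<lambda>d. c (edge G d)) (ends_at G v))"

definition snark :: "('v, 'd) multipole \<Rightarrow> bool" where
  "snark G \<longleftrightarrow> cubic_graph G \<and> two_connected G \<and> (\<nexists>c. proper_3_edge_colouring G c)"

definition bipartite_graph :: "('v, 'd) multipole \<Rightarrow> bool" where
  "bipartite_graph G \<longleftrightarrow> (\<exists>X\<subseteq>verts G. \<forall>d\<in>ends G.
     endv G d \<in> Some ` X \<longleftrightarrow> endv G (mate G d) \<notin> Some ` X)"

text \<open>A circuit is given by the list of the initial ends of its edges, traversed cyclically.\<close>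

definition circuit :: "('v, 'd) multipole \<Rightarrow> 'd list \<Rightarrow> bool" where
  "circuit G C \<longleftrightarrow> C \<noteq> [] \<and> set C \<subseteq> ends G \<and>
     (\<forall>i<length C. endv G (C ! i) \<noteq> None \<and>
        endv G (mate G (C ! i)) = endv G (C ! (Suc i mod length C))) \<and>
     distinct (map (endv G) C) \<and> distinct (map (edge G) C)"

definition tree :: "('v, 'd) multipole \<Rightarrow> bool" where
  "tree G \<longleftrightarrow> connected_graph G \<and> (\<nexists>C. circuit G C)"


section \<open>Real-valued flows\<close>

text \<open>
  An orientation selects one end of each edge: the end at which the edge leaves its
  initial vertex.
\<close>

definition orientation :: "('v, 'd) multipole \<Rightarrow> 'd set \<Rightarrow> bool" where
  "orientation G A \<longleftrightarrow> A \<subseteq> ends G \<and> (\<forall>d\<in>ends G. d \<in> A \<longleftrightarrow> mate G d \<notin> A)"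

definition real_flow :: "('v, 'd) multipole \<Rightarrow> 'd set \<Rightarrow> ('d set \<Rightarrow> real) \<Rightarrow> bool" where
  "real_flow G A \<phi> \<longleftrightarrow> (\<forall>v\<in>verts G.
     (\<Sum>d\<in>ends_at G v - A. \<phi> (edge G d)) = (\<Sum>d\<in>ends_at G v \<inter> A. \<phi> (edge G d)))"

definition has_nowhere_zero_flow :: "('v, 'd) multipole \<Rightarrow> real \<Rightarrow> bool" where
  "has_nowhere_zero_flow G r \<longleftrightarrow> (\<exists>A \<phi>. orientation G A \<and> real_flow G A \<phi> \<and>
     (\<forall>e\<in>edges G. 1 \<le> \<bar>\<phi> e\<bar> \<and> \<bar>\<phi> e\<bar> \<le> r - 1))"

text \<open>The value is \<open>\<infinity>\<close> for graphs without any nowhere-zero flow.\<close>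

definition circular_flow_number :: "('v, 'd) multipole \<Rightarrow> ereal" where
  "circular_flow_number G = Inf {ereal r | r. 2 \<le> r \<and> has_nowhere_zero_flow G r}"


section \<open>Poles, junctions and joins\<close>

text \<open>
  The residual semiedges form a set, which is empty for (2,2)-poles and a
  singleton for (2,2;1)-poles.
\<close>

record ('v, 'd) pole = "('v, 'd) multipole" +
  inp :: "'d set"
  outp :: "'d set"
  resid :: "'d set"

definition pole_2_2 :: "('v, 'd) pole \<Rightarrow> bool" where
  "pole_2_2 M \<longleftrightarrow> cubic_multipole M \<and> semiedges M = inp M \<union> outp M \<and>
     inp M \<inter> outp M = {} \<and> card (inp M) = 2 \<and> card (outp M) = 2 \<and> resid M = {}"

text \<open>
  A path \<open>uv\<close> or \<open>uwv\<close> is given by the initial end of each of its edges, which also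
  determines the edges in the presence of parallel ones.
\<close>

definition path1 :: "('v, 'd) multipole \<Rightarrow> 'd \<Rightarrow> bool" where
  "path1 G d \<longleftrightarrow> d \<in> ends G \<and> endv G d \<noteq> endv G (mate G d)"

definition path2 :: "('v, 'd) multipole \<Rightarrow> 'd \<Rightarrow> 'd \<Rightarrow> bool" where
  "path2 G d e \<longleftrightarrow> d \<in> ends G \<and> e \<in> ends G \<and> endv G (mate G d) = endv G e \<and>
     distinct [endv G d, endv G e, endv G (mate G e)]"

text \<open>
  Removal of the vertices \<open>X\<close> and the edges \<open>E\<close>; the remaining ends incident with vertices
  in \<open>X\<close> become free.
\<close>

definition detach :: "('v, 'd) multipole \<Rightarrow> 'v set \<Rightarrow> 'd set set \<Rightarrow> ('v, 'd) multipole" where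
  "detach G X E = G\<lparr>verts := verts G - X, ends := ends G - \<Union>E,
     endv := (\<lambda>d. if endv G d \<in> Some ` X then None else endv G d)\<rparr>"

definition make_pole :: "('v, 'd) multipole \<Rightarrow> 'd set \<Rightarrow> 'd set \<Rightarrow> 'd set \<Rightarrow> ('v, 'd) pole" where
  "make_pole M I J R = multipole.extend M (pole.fields I J R)"

text \<open>\<open>G\<^sub>u\<^sub>v\<close> and \<open>G\<^sub>u\<^sub>w\<^sub>v\<close>, where the path is given by \<open>d\<close> and by \<open>d, e\<close>, respectively.\<close>

definition remove_path1 :: "('v, 'd) multipole \<Rightarrow> 'd \<Rightarrow> ('v, 'd) pole" where
  "remove_path1 G d =
     (let u = the (endv G d); v = the (endv G (mate G d)); E = {edge G d}
      in make_pole (detach G {u, v} E) (ends_at G u - \<Union>E) (ends_at G v - \<Union>E) {})"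

definition remove_path2 :: "('v, 'd) multipole \<Rightarrow> 'd \<Rightarrow> 'd \<Rightarrow> ('v, 'd) pole" where
  "remove_path2 G d e =
     (let u = the (endv G d); w = the (endv G e); v = the (endv G (mate G e));
          E = {edge G d, edge G e}
      in make_pole (detach G {u, w, v} E)
           (ends_at G u - \<Union>E) (ends_at G v - \<Union>E) (ends_at G w - \<Union>E))"

definition bipartite_2_2_1_pole :: "('v, 'd) pole \<Rightarrow> bool" where
  "bipartite_2_2_1_pole B \<longleftrightarrow> (\<exists>G d e. cubic_graph G \<and> bipartite_graph G \<and> path2 G d e \<and>
     B = remove_path2 G d e)"

definition disjoint_multipoles ::
    "('v, 'd, 'y) multipole_scheme \<Rightarrow> ('v, 'd, 'z) multipole_scheme \<Rightarrow> bool" where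
  "disjoint_multipoles M N \<longleftrightarrow> verts M \<inter> verts N = {} \<and> ends M \<inter> ends N = {}"

text \<open>Meaningful for disjoint multipoles only.\<close>

definition munion ::
    "('v, 'd, 'y) multipole_scheme \<Rightarrow> ('v, 'd, 'z) multipole_scheme \<Rightarrow> ('v, 'd) multipole" where
  "munion M N = \<lparr>verts = verts M \<union> verts N, ends = ends M \<union> ends N,
     mate = (\<lambda>d. if d \<in> ends M then mate M d else mate N d),
     endv = (\<lambda>d. if d \<in> ends M then endv M d else endv N d)\<rparr>"

text \<open>
  The junction of two free ends removes both of them; their edges are merged into the edge
  consisting of the other two ends.
\<close>

definition junction :: "'d \<times> 'd \<Rightarrow> ('v, 'd) multipole \<Rightarrow> ('v, 'd) multipole" where
  "junction p M = (case p of (a, b) \<Rightarrow> M\<lparr>ends := ends M - {a, b},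
     mate := (mate M)(mate M a := mate M b, mate M b := mate M a)\<rparr>)"

definition junctions :: "('d \<times> 'd) list \<Rightarrow> ('v, 'd) multipole \<Rightarrow> ('v, 'd) multipole" where
  "junctions ps M = fold junction ps M"

text \<open>\<open>ps\<close> lists the pairs of a bijection between the connectors \<open>J\<close> and \<open>I\<close>.\<close>

definition connector_matching :: "'d set \<Rightarrow> 'd set \<Rightarrow> ('d \<times> 'd) list \<Rightarrow> bool" where
  "connector_matching J I ps \<longleftrightarrow> distinct (map fst ps) \<and> set (map fst ps) = J \<and>
     distinct (map snd ps) \<and> set (map snd ps) = I"

definition is_join :: "('v, 'd) pole \<Rightarrow> ('v, 'd) pole \<Rightarrow> ('v, 'd) pole \<Rightarrow> bool" where
  "is_join M N K \<longleftrightarrow> disjoint_multipoles M N \<and>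
     (\<exists>ps. connector_matching (outp M) (inp N) ps \<and>
        K = make_pole (junctions ps (munion M N)) (inp M) (outp N) (resid M \<union> resid N))"

definition attach :: "'d \<Rightarrow> 'v \<Rightarrow> ('v, 'd) multipole \<Rightarrow> ('v, 'd) multipole" where
  "attach d v M = M\<lparr>endv := (endv M)(d := Some v)\<rparr>"


section \<open>Decollineators\<close>

definition basis_F2_4 :: "(4 \<Rightarrow> bit ^ 4) \<Rightarrow> bool" where
  "basis_F2_4 p \<longleftrightarrow> inj p \<and> vec.independent (range p) \<and> vec.span (range p) = UNIV"

definition T_points :: "(4 \<Rightarrow> bit ^ 4) \<Rightarrow> (bit ^ 4) set" where
  "T_points p = range p \<union> {p i + p j | i j. i \<noteq> j}"

definition T_lines :: "(4 \<Rightarrow> bit ^ 4) \<Rightarrow> (bit ^ 4) set set" where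
  "T_lines p = {{p i, p i + p j, p j} | i j. i \<noteq> j}"

text \<open>
  In a cubic multipole a vertex has three ends and a line has three points, so the equation of
  image and line below makes the three values at a vertex distinct.
\<close>

definition T_flow ::
    "(4 \<Rightarrow> bit ^ 4) \<Rightarrow> ('v, 'd, 'z) multipole_scheme \<Rightarrow> ('d set \<Rightarrow> bit ^ 4) \<Rightarrow> bool" where
  "T_flow p M t \<longleftrightarrow> (\<forall>e\<in>edges M. t e \<in> T_points p) \<and>
     (\<forall>v\<in>verts M. (\<lambda>d. t (edge M d)) ` ends_at M v \<in> T_lines p)"

definition distinct_collinear_on ::
    "(4 \<Rightarrow> bit ^ 4) \<Rightarrow> ('v, 'd, 'z) multipole_scheme \<Rightarrow> ('d set \<Rightarrow> bit ^ 4) \<Rightarrow> 'd set \<Rightarrow> bool" where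
  "distinct_collinear_on p M t I \<longleftrightarrow> inj_on (\<lambda>d. t (edge M d)) I \<and>
     (\<exists>L\<in>T_lines p. (\<lambda>d. t (edge M d)) ` I \<subseteq> L)"

definition decollineator :: "(4 \<Rightarrow> bit ^ 4) \<Rightarrow> ('v, 'd) pole \<Rightarrow> bool" where
  "decollineator p D \<longleftrightarrow> pole_2_2 D \<and>
     (\<nexists>t. T_flow p D t \<and> distinct_collinear_on p D t (inp D) \<and>
          distinct_collinear_on p D t (outp D))"


section \<open>Halin graphs and Halin snarks\<close>

text \<open>
  A plane drawing: \<open>pos\<close> places the vertices, and \<open>\<gamma> d\<close> is a simple arc for the edge of \<open>d\<close>,
  traversed starting from the end \<open>d\<close>.
\<close>

definition plane_embedding ::
    "('v, 'd) multipole \<Rightarrow> ('v \<Rightarrow> complex) \<Rightarrow> ('d \<Rightarrow> real \<Rightarrow> complex) \<Rightarrow> bool" where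
  "plane_embedding G pos \<gamma> \<longleftrightarrow> inj_on pos (verts G) \<and>
     (\<forall>d\<in>ends G. simple_path (\<gamma> d) \<and> \<gamma> (mate G d) = reversepath (\<gamma> d) \<and>
        pathstart (\<gamma> d) = pos (the (endv G d)) \<and>
        path_image (\<gamma> d) \<inter> pos ` verts G = {pathstart (\<gamma> d), pathfinish (\<gamma> d)}) \<and>
     (\<forall>d\<in>ends G. \<forall>d'\<in>ends G. edge G d \<noteq> edge G d' \<longrightarrow>
        path_image (\<gamma> d) \<inter> path_image (\<gamma> d') \<subseteq> pos ` verts G)"

definition drawing ::
    "('v, 'd) multipole \<Rightarrow> ('v \<Rightarrow> complex) \<Rightarrow> ('d \<Rightarrow> real \<Rightarrow> complex) \<Rightarrow> complex set" where
  "drawing G pos \<gamma> = pos ` verts G \<union> (\<Union>d\<in>ends G. path_image (\<gamma> d))"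

text \<open>\<open>outside\<close> of the drawing, which is a bounded set, is its unique unbounded face.\<close>

definition bounds_outer_face ::
    "('v, 'd) multipole \<Rightarrow> ('v \<Rightarrow> complex) \<Rightarrow> ('d \<Rightarrow> real \<Rightarrow> complex) \<Rightarrow> 'd list \<Rightarrow> bool" where
  "bounds_outer_face G pos \<gamma> C \<longleftrightarrow>
     frontier (outside (drawing G pos \<gamma>)) = (\<Union>d\<in>set C. path_image (\<gamma> d))"

text \<open>The tree \<open>S\<close> of a Halin graph \<open>H = C \<union> S\<close>.\<close>

definition halin_tree :: "('v, 'd) multipole \<Rightarrow> 'd list \<Rightarrow> ('v, 'd) multipole" where
  "halin_tree H C = delete_edges H (edge H ` set C)"

definition cvert :: "('v, 'd) multipole \<Rightarrow> 'd list \<Rightarrow> nat \<Rightarrow> 'v" where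
  "cvert H C i = the (endv H (C ! i))"

definition cubic_halin_graph :: "('v, 'd) multipole \<Rightarrow> 'd list \<Rightarrow> bool" where
  "cubic_halin_graph H C \<longleftrightarrow> cubic_graph H \<and> circuit H C \<and>
     (let S = halin_tree H C in
        tree S \<and> (\<forall>v\<in>verts S. degree S v \<in> {1, 3}) \<and> (\<exists>v\<in>verts S. degree S v = 3) \<and>
        cvert H C ` {..<length C} = {v \<in> verts S. degree S v = 1}) \<and>
     (\<exists>pos \<gamma>. plane_embedding H pos \<gamma> \<and> bounds_outer_face H pos \<gamma> C)"

text \<open>The tree \<open>S - {v\<^sub>0, \<dots>, v\<^sub>k\<^sub>-\<^sub>1}\<close>, and the neighbour of \<open>v\<^sub>i\<close> in \<open>S\<close>.\<close>

definition halin_inner_tree :: "('v, 'd) multipole \<Rightarrow> 'd list \<Rightarrow> ('v, 'd) multipole" where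
  "halin_inner_tree H C = delete_verts (halin_tree H C) (cvert H C ` {..<length C})"

definition tree_neighbour :: "('v, 'd) multipole \<Rightarrow> 'd list \<Rightarrow> nat \<Rightarrow> 'v" where
  "tree_neighbour H C i = (THE w. (cvert H C i, w) \<in> adj (halin_tree H C))"

definition halin_fragment ::
    "(4 \<Rightarrow> bit ^ 4) \<Rightarrow> ('v, 'd) pole \<Rightarrow> ('v, 'd) pole \<Rightarrow> ('v, 'd) pole \<Rightarrow> bool" where
  "halin_fragment p D B F \<longleftrightarrow> decollineator p D \<and> bipartite_2_2_1_pole B \<and> is_join D B F"

text \<open>
  \<open>G\<close> is a Halin snark built from the Halin graph \<open>H\<close> with circuit \<open>C\<close> and the fragments
  \<open>F i = D i \<circ> B i\<close>. The constituents are taken to be literally disjoint rather than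
  replaced by disjoint copies. The two ways of performing the junctions of two connectors are
  covered by the choice of \<open>P i\<close>.
\<close>

definition halin_snark ::
    "(4 \<Rightarrow> bit ^ 4) \<Rightarrow> ('v, 'd) multipole \<Rightarrow> 'd list \<Rightarrow> (nat \<Rightarrow> ('v, 'd) pole) \<Rightarrow>
     (nat \<Rightarrow> ('v, 'd) pole) \<Rightarrow> (nat \<Rightarrow> ('v, 'd) pole) \<Rightarrow> ('v, 'd) multipole \<Rightarrow> bool" where
  "halin_snark p H C D B F G \<longleftrightarrow>
     (let k = length C; S' = halin_inner_tree H C in
        cubic_halin_graph H C \<and>
        (\<forall>i<k. halin_fragment p (D i) (B i) (F i)) \<and>
        (\<forall>i<k. disjoint_multipoles (F i) S') \<and>
        (\<forall>i<k. \<forall>j<k. i \<noteq> j \<longrightarrow> disjoint_multipoles (F i) (F j)) \<and>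
        (\<exists>P. (\<forall>i<k. connector_matching (outp (F i)) (inp (F (Suc i mod k))) (P i)) \<and>
           G = fold (\<lambda>i. attach (the_elem (resid (F i))) (tree_neighbour H C i)) [0..<k]
                 (junctions (concat (map P [0..<k]))
                   (foldr (\<lambda>i. munion (F i)) [0..<k] S'))))"

end

theory Submission
  imports Defs
begin

text \<open>
  Suppose that \<open>G\<close> has a nowhere-zero \<open>r\<close>-flow with \<open>r < 5\<close>. The total flow \<open>f\<^sub>i\<close> through the
  decollineator \<open>D\<^sub>i\<close> is within distance less than 1 of a multiple of \<open>r\<close>: otherwise the flow would
  extend over the removed edge, modulo \<open>r\<close> and then also over the reals, to an \<open>r\<close>-flow of the
  snark that \<open>D\<^sub>i\<close> comes from. The residual semiedge of the \<open>i\<close>-th fragment carries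
  \<open>f\<^sub>i\<^sub>+\<^sub>1 - f\<^sub>i\<close>. The tree has a vertex with two leaf neighbours; by planarity these are consecutive
  on the circuit, so the three edges at this vertex carry \<open>f\<^sub>i\<^sub>+\<^sub>1 - f\<^sub>i\<close>, \<open>f\<^sub>i\<^sub>+\<^sub>2 - f\<^sub>i\<^sub>+\<^sub>1\<close> and
  \<open>f\<^sub>i - f\<^sub>i\<^sub>+\<^sub>2\<close>. Modulo \<open>r\<close> these are three numbers of absolute value in \<open>[1, 2)\<close> with sum 0,
  which is impossible.
\<close>

section \<open>Flows as skew functions on edge ends\<close>

text \<open>The obstacle to extending a flow over a removed edge is size: conservation forces on
  that edge the total through the pole, which may reach \<open>2 * (r - 1)\<close> in absolute
  value. If this is too large, it is lowered by \<open>r\<close> along a closed trail of positive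
  edges; the other edges of the trail stay admissible because subtracting \<open>r\<close> maps the
  interval from 1 to \<open>r - 1\<close> onto its negative. Flows are functions on edge ends that
  \<open>mate\<close> negates. This avoids orientations and allows a flow to be cut open at a
  junction: the two removed ends receive opposite values, so that totals over connectors can be
  passed from one fragment to the next. The drawing consists of arbitrary curves, so planarity is
  used through the Jordan curve theorem: a chord splits the inside of the outer circuit.\<close>

definition involutive :: "('v, 'd, 'z) multipole_scheme \<Rightarrow> bool" where
  "involutive M \<longleftrightarrow>
     (\<forall>d\<in>ends M. mate M d \<in> ends M \<and> mate M d \<noteq> d \<and> mate M (mate M d) = d)"

text \<open>\<open>g d\<close> is the amount leaving through the end \<open>d\<close>; both
  directions of an edge are recorded, so no orientation has to be chosen.\<close>

definition skew :: "('v, 'd, 'z) multipole_scheme \<Rightarrow> ('d \<Rightarrow> real) \<Rightarrow> bool" where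
  "skew M g \<longleftrightarrow> (\<forall>d\<in>ends M. g (mate M d) = - g d)"

definition outflow :: "('v, 'd, 'z) multipole_scheme \<Rightarrow> ('d \<Rightarrow> real) \<Rightarrow> 'v \<Rightarrow> real" where
  "outflow M g v = (\<Sum>d\<in>ends_at M v. g d)"

text \<open>Kept apart from conservation at vertices because junctions affect only edges: this part
  of a flow is pulled back through them without mention of vertices.\<close>

definition nz_skew :: "('v, 'd, 'z) multipole_scheme \<Rightarrow> real \<Rightarrow> ('d \<Rightarrow> real) \<Rightarrow> bool" where
  "nz_skew M r g \<longleftrightarrow> skew M g \<and> (\<forall>d\<in>ends M. 1 \<le> \<bar>g d\<bar> \<and> \<bar>g d\<bar> \<le> r - 1)"

definition end_flow :: "('v, 'd, 'z) multipole_scheme \<Rightarrow> real \<Rightarrow> ('d \<Rightarrow> real) \<Rightarrow> bool" where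
  "end_flow M r g \<longleftrightarrow> nz_skew M r g \<and> (\<forall>v\<in>verts M. outflow M g v = 0)"

lemma wf_imp_involutive: "wf_multipole M \<Longrightarrow> involutive M"
  by (auto simp: wf_multipole_def involutive_def)

lemma involutiveD:
  assumes "involutive M" "d \<in> ends M"
  shows "mate M d \<in> ends M" "mate M d \<noteq> d" "mate M (mate M d) = d"
  using assms by (auto simp: involutive_def)

lemma involutive_mate_eq_iff:
  "involutive M \<Longrightarrow> c \<in> ends M \<Longrightarrow> d \<in> ends M \<Longrightarrow> mate M c = mate M d \<longleftrightarrow> c = d"
  by (metis involutiveD(3))

lemma edge_mate: "involutive M \<Longrightarrow> d \<in> ends M \<Longrightarrow> edge M (mate M d) = edge M d"
  by (auto simp: edge_def involutive_def)

lemma finite_ends_at: "finite (ends M) \<Longrightarrow> finite (ends_at M v)"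
  by (simp add: ends_at_def)

lemma cubic_graph_endv:
  assumes "cubic_graph M" "d \<in> ends M"
  obtains v where "v \<in> verts M" "endv M d = Some v"
  using assms by (auto simp: cubic_graph_def cubic_multipole_def wf_multipole_def semiedges_def)

lemma has_flow_imp_end_flow:
  fixes G :: "('v, 'd) multipole"
  assumes "involutive G" "finite (ends G)" "has_nowhere_zero_flow G r"
  obtains g where "end_flow G r g"
proof -
  obtain A \<phi> where A: "orientation G A" and f: "real_flow G A \<phi>"
    and b: "\<forall>e\<in>edges G. 1 \<le> \<bar>\<phi> e\<bar> \<and> \<bar>\<phi> e\<bar> \<le> r - 1"
    using assms(3) by (auto simp: has_nowhere_zero_flow_def)
  define g where "g d = (if d \<in> A then \<phi> (edge G d) else - \<phi> (edge G d))" for d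
  have "skew G g"
    using A assms(1) by (auto simp: skew_def g_def orientation_def edge_mate)
  moreover have "1 \<le> \<bar>g d\<bar> \<and> \<bar>g d\<bar> \<le> r - 1" if "d \<in> ends G" for d
    using b that by (auto simp: g_def edges_def)
  moreover have "outflow G g v = 0" if "v \<in> verts G" for v
  proof -
    have fin: "finite (ends_at G v)" using assms(2) by (rule finite_ends_at)
    have "outflow G g v = (\<Sum>d\<in>ends_at G v \<inter> A. g d) + (\<Sum>d\<in>ends_at G v - A. g d)"
      unfolding outflow_def by (subst sum.Int_Diff[OF fin, of _ A]) simp
    also have "(\<Sum>d\<in>ends_at G v \<inter> A. g d) = (\<Sum>d\<in>ends_at G v \<inter> A. \<phi> (edge G d))"
      by (rule sum.cong) (auto simp: g_def)
    also have "(\<Sum>d\<in>ends_at G v - A. g d) = - (\<Sum>d\<in>ends_at G v - A. \<phi> (edge G d))"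
      unfolding sum_negf[symmetric] by (rule sum.cong) (auto simp: g_def)
    finally show ?thesis using f that by (simp add: real_flow_def)
  qed
  ultimately have "end_flow G r g" by (auto simp: end_flow_def nz_skew_def)
  then show thesis by (rule that)
qed

lemma end_flow_imp_has_flow:
  fixes G :: "('v, 'd) multipole"
  assumes "involutive G" "finite (ends G)" "end_flow G r g"
  shows "has_nowhere_zero_flow G r"
proof -
  \<comment> \<open>Each edge is oriented in the direction in which \<open>g\<close> is positive.
    Its value is the common absolute value at its two ends; \<open>Max\<close> reads this off the
    edge as a set.\<close>
  define A where "A = {d \<in> ends G. g d > 0}"
  define \<phi> where "\<phi> e = Max ((\<lambda>d. \<bar>g d\<bar>) ` e)" for e
  have skew: "g (mate G d) = - g d" and b: "1 \<le> \<bar>g d\<bar>" "\<bar>g d\<bar> \<le> r - 1" if "d \<in> ends G" for d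
    using assms(3) that by (auto simp: end_flow_def nz_skew_def skew_def)
  have \<phi>: "\<phi> (edge G d) = \<bar>g d\<bar>" if "d \<in> ends G" for d
    using skew[OF that] by (simp add: \<phi>_def edge_def)
  have "orientation G A"
    unfolding orientation_def A_def
    using skew b(1) assms(1) by (force simp: involutive_def)
  moreover have "real_flow G A \<phi>"
    unfolding real_flow_def
  proof
    fix v assume v: "v \<in> verts G"
    have fin: "finite (ends_at G v)" using assms(2) by (rule finite_ends_at)
    have sub: "ends_at G v \<subseteq> ends G" by (auto simp: ends_at_def)
    have "0 = (\<Sum>d\<in>ends_at G v. g d)"
      using assms(3) v by (simp add: end_flow_def nz_skew_def outflow_def)
    also have "\<dots> = (\<Sum>d\<in>ends_at G v \<inter> A. g d) + (\<Sum>d\<in>ends_at G v - A. g d)"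
      by (subst sum.Int_Diff[OF fin, of _ A]) simp
    also have "(\<Sum>d\<in>ends_at G v \<inter> A. g d) = (\<Sum>d\<in>ends_at G v \<inter> A. \<phi> (edge G d))"
      using sub by (intro sum.cong) (auto simp: \<phi> A_def)
    also have "(\<Sum>d\<in>ends_at G v - A. g d) = - (\<Sum>d\<in>ends_at G v - A. \<phi> (edge G d))"
      unfolding sum_negf[symmetric] using sub by (intro sum.cong) (auto simp: \<phi> A_def)
    finally show "(\<Sum>d\<in>ends_at G v - A. \<phi> (edge G d)) = (\<Sum>d\<in>ends_at G v \<inter> A. \<phi> (edge G d))"
      by simp
  qed
  moreover have "\<forall>e\<in>edges G. 1 \<le> \<bar>\<phi> e\<bar> \<and> \<bar>\<phi> e\<bar> \<le> r - 1"
    using b by (auto simp: edges_def \<phi>)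
  ultimately show ?thesis by (auto simp: has_nowhere_zero_flow_def)
qed

text \<open>Reindexing by \<open>mate\<close> turns the sum into its own negative.\<close>

lemma sum_skew_closed:
  assumes "involutive M" "skew M g" "T \<subseteq> ends M" "mate M ` T \<subseteq> T"
  shows "(\<Sum>d\<in>T. g d) = 0"
proof -
  have "(\<Sum>d\<in>T. g d) = (\<Sum>d\<in>T. g (mate M d))"
    by (rule sum.reindex_bij_witness[of _ "mate M" "mate M"])
      (use assms in \<open>auto simp: involutive_def subset_iff\<close>)
  also have "\<dots> = (\<Sum>d\<in>T. - g d)"
    by (rule sum.cong) (use assms in \<open>auto simp: skew_def\<close>)
  finally show ?thesis by (simp add: sum_negf)
qed

lemma sum_ends_at_verts:
  assumes "finite (ends M)" "finite V"
  shows "(\<Sum>d | d \<in> ends M \<and> endv M d \<in> Some ` V. g d) = (\<Sum>v\<in>V. outflow M g v)"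
proof -
  have "{d \<in> ends M. endv M d \<in> Some ` V} = (\<Union>v\<in>V. ends_at M v)"
    by (auto simp: ends_at_def)
  then show ?thesis
    unfolding outflow_def
    by (simp only:) (rule sum.UNION_disjoint, use assms in \<open>auto simp: ends_at_def\<close>)
qed

text \<open>The sum over all ends vanishes by skewness and its part at vertices by conservation, so
  the part at free ends vanishes too. This is the conservation law for a whole pole.\<close>

lemma sum_semiedges:
  assumes "wf_multipole M" "skew M g" "\<forall>v\<in>verts M. outflow M g v = 0"
  shows "(\<Sum>d\<in>semiedges M. g d) = 0"
proof -
  have fin: "finite (ends M)" "finite (verts M)" using assms by (auto simp: wf_multipole_def)
  let ?I = "{d. d \<in> ends M \<and> endv M d \<in> Some ` verts M}"
  have eq: "ends M = ?I \<union> semiedges M"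
    using assms(1) by (auto simp: wf_multipole_def semiedges_def image_iff) 
  have "0 = (\<Sum>d\<in>ends M. g d)"
    by (rule sum_skew_closed[symmetric])
      (use assms wf_imp_involutive in \<open>auto simp: wf_multipole_def\<close>)
  also have "\<dots> = (\<Sum>d\<in>?I. g d) + (\<Sum>d\<in>semiedges M. g d)"
    by (subst eq, rule sum.union_disjoint) (use fin in \<open>auto simp: semiedges_def\<close>)
  also have "(\<Sum>d\<in>?I. g d) = 0"
    using assms(3) by (subst sum_ends_at_verts) (auto simp: fin)
  finally show ?thesis by simp
qed

section \<open>Walks, and shifting a flow by \<open>r\<close> along them\<close>

fun walk :: "('v, 'd, 'z) multipole_scheme \<Rightarrow> 'v option \<Rightarrow> 'd list \<Rightarrow> 'v option \<Rightarrow> bool" where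
  "walk M x [] y \<longleftrightarrow> x = y"
| "walk M x (d # ds) y \<longleftrightarrow> endv M d = x \<and> walk M (endv M (mate M d)) ds y"

lemma walk_append: "walk M x (ds @ es) y \<longleftrightarrow> (\<exists>z. walk M x ds z \<and> walk M z es y)"
  by (induction ds arbitrary: x) auto

text \<open>A shortest walk works, since the stretch between two occurrences of an end could be cut
  out. Minimality is passed on because \<open>repair_flow\<close> uses it once more, to keep the bad
  edge off the walk.\<close>

lemma walk_distinct_ends:
  assumes "walk M x ds y" "set ds \<subseteq> A"
  obtains es where "walk M x es y" "set es \<subseteq> A" "distinct es"
    "\<And>ds'. walk M x ds' y \<Longrightarrow> set ds' \<subseteq> A \<Longrightarrow> length es \<le> length ds'"
proof -
  define P where "P es \<longleftrightarrow> walk M x es y \<and> set es \<subseteq> A" for es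
  define es where "es = (ARG_MIN length es. P es)"
  have es: "P es" and min: "\<And>ds'. P ds' \<Longrightarrow> length es \<le> length ds'"
    unfolding es_def using arg_min_nat_lemma[of P ds length] assms by (auto simp: P_def)
  have "distinct es"
  proof (rule ccontr)
    assume "\<not> distinct es"
    then obtain xs ys zs d where eq: "es = xs @ [d] @ ys @ [d] @ zs"
      using not_distinct_decomp by blast
    with es have "P (xs @ [d] @ zs)"
      by (auto simp: P_def walk_append)
    from min[OF this] eq show False by simp
  qed
  with es min show thesis by (intro that) (auto simp: P_def)
qed

text \<open>Each passage through \<open>z\<close> is one arrival and one departure; only the start
  gives an unmatched departure and only the finish an unmatched arrival.\<close>

lemma walk_count:
  assumes "walk M x ds y"
  shows "length (filter (\<lambda>d. endv M d = z) ds) + (if y = z then 1 else 0) =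
    length (filter (\<lambda>d. endv M (mate M d) = z) ds) + (if x = z then 1 else (0 :: nat))"
  using assms
proof (induction ds arbitrary: x)
  case (Cons d ds)
  from Cons.prems have "walk M (endv M (mate M d)) ds y" "endv M d = x" by auto
  from Cons.IH[OF this(1)] this(2) show ?case by (auto split: if_splits)
qed auto

text \<open>Membership in a set is tested, so an end traversed twice would count once; hence the
  distinctness assumption of \<open>outflow_push\<close>. If a walk uses an edge in both directions,
  the two changes cancel.\<close>

definition push ::
    "('v, 'd, 'z) multipole_scheme \<Rightarrow> real \<Rightarrow> 'd list \<Rightarrow> ('d \<Rightarrow> real) \<Rightarrow> 'd \<Rightarrow> real" where
  "push M r ds g d =
     g d - (if d \<in> set ds then r else 0) + (if mate M d \<in> set ds then r else 0)"

lemma skew_push: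
  assumes "involutive M" "skew M g"
  shows "skew M (push M r ds g)"
  using assms by (auto simp: skew_def push_def involutive_def)

text \<open>By \<open>walk_count\<close>, the changes due to departures and arrivals cancel except
  at the extremities of the walk; distinctness turns the counts along the list into numbers of ends
  at \<open>v\<close>.\<close>

lemma outflow_push:
  assumes M: "involutive M" "finite (ends M)"
    and ds: "walk M x ds y" "set ds \<subseteq> ends M" "distinct ds"
  shows "outflow M (push M r ds g) v =
    outflow M g v - (if x = Some v then r else 0) + (if y = Some v then r else 0)"
proof -
  have fin: "finite (ends_at M v)" using M(2) by (rule finite_ends_at)
  let ?m = "length (filter (\<lambda>d. endv M d = Some v) ds)"
  let ?n = "length (filter (\<lambda>d. endv M (mate M d) = Some v) ds)"
  have "?m = card (ends_at M v \<inter> set ds)"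
    unfolding distinct_length_filter[OF ds(3)]
    by (rule arg_cong[where f = card]) (use ds(2) in \<open>auto simp: ends_at_def\<close>)
  then have 1: "(\<Sum>d\<in>ends_at M v. if d \<in> set ds then r else 0) = r * ?m"
    using fin by (simp add: sum.If_cases)
  have "?n = card {d \<in> ends_at M v. mate M d \<in> set ds}"
    unfolding distinct_length_filter[OF ds(3)]
    by (rule bij_betw_same_card[where f = "mate M"],
        rule bij_betw_byWitness[where f' = "mate M"])
      (use ds(2) M(1) in \<open>auto simp: ends_at_def involutive_def subset_iff\<close>)
  moreover have "{d \<in> ends_at M v. mate M d \<in> set ds} = ends_at M v \<inter> {d. mate M d \<in> set ds}"
    by auto
  ultimately have 2: "(\<Sum>d\<in>ends_at M v. if mate M d \<in> set ds then r else 0) = r * ?n"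
    using fin by (simp add: sum.If_cases)
  have "real ?m + (if y = Some v then 1 else 0) = real ?n + (if x = Some v then 1 else 0)"
    using arg_cong[OF walk_count[OF ds(1), of "Some v"], of real] by (auto split: if_splits)
  then have "r * ?m + (if y = Some v then r else 0) = r * ?n + (if x = Some v then r else 0)"
    by (auto simp: algebra_simps split: if_splits dest: arg_cong[where f = "\<lambda>a. r * a"])
  moreover have "outflow M (push M r ds g) v = outflow M g v - r * ?m + r * ?n"
    unfolding outflow_def push_def by (simp add: sum.distrib sum_subtractf 1 2)
  ultimately show ?thesis by auto
qed

text \<open>A cut argument: let \<open>R\<close> be what positive ends reach from the head of
  \<open>d\<close>. If the tail of \<open>d\<close> were outside \<open>R\<close>, no end leaving
  \<open>R\<close> would be positive and \<open>mate M d\<close> would be negative, although the net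
  flow out of \<open>R\<close> is zero.\<close>

lemma positive_return_walk:
  assumes M: "wf_multipole M" "semiedges M = {}"
    and g: "skew M g" "\<forall>v\<in>verts M. outflow M g v = 0"
    and d: "d \<in> ends M" "g d > 0"
  obtains ds where "walk M (endv M (mate M d)) ds (endv M d)" "set ds \<subseteq> {d \<in> ends M. g d > 0}"
proof -
  define R where "R = {x. \<exists>ds. set ds \<subseteq> {d \<in> ends M. g d > 0} \<and> walk M (endv M (mate M d)) ds x}"
  define S where "S = {d \<in> ends M. endv M d \<in> R}"
  have inv: "involutive M" using M(1) by (rule wf_imp_involutive)
  note inv' = involutiveD[OF inv]
  have fin: "finite (ends M)" "finite (verts M)" using M(1) by (auto simp: wf_multipole_def)
  have "endv M d \<in> R"
  proof (rule ccontr)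
    assume nR: "endv M d \<notin> R"
    have "endv M (mate M d) \<in> R" by (auto simp: R_def intro!: exI[of _ "[]"])
    then have mS: "mate M d \<in> S" using inv'[OF d(1)] by (auto simp: S_def)
    have "S = {e \<in> ends M. endv M e \<in> Some ` {v \<in> verts M. Some v \<in> R}}"
      using M by (auto simp: S_def wf_multipole_def semiedges_def image_iff)
    then have "(\<Sum>e\<in>S. g e) = (\<Sum>v | v \<in> verts M \<and> Some v \<in> R. outflow M g v)"
      using sum_ends_at_verts[of M "{v \<in> verts M. Some v \<in> R}" g] fin by simp
    also have "\<dots> = 0" using g(2) by simp
    finally have 0: "(\<Sum>e\<in>S. g e) = 0" .
    \<comment> \<open>Edges with both ends in \<open>R\<close> contribute nothing, so the whole sum
      sits on the cut \<open>S - ?T\<close>.\<close>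
    let ?T = "{e \<in> S. mate M e \<in> S}"
    have T0: "(\<Sum>e\<in>?T. g e) = 0"
      by (rule sum_skew_closed[OF inv g(1)]) (auto simp: S_def inv')
    have finS: "finite S" using fin by (simp add: S_def)
    have "(\<Sum>e\<in>S. g e) = (\<Sum>e\<in>S - ?T. g e) + (\<Sum>e\<in>?T. g e)"
      by (rule sum.subset_diff) (use finS in auto)
    moreover have "(\<Sum>e\<in>S - ?T. g e) < (\<Sum>e\<in>S - ?T. 0)"
    proof (rule sum_strict_mono_ex1)
      show "\<forall>e\<in>S - ?T. g e \<le> 0"
      proof
        fix e assume e: "e \<in> S - ?T"
        show "g e \<le> 0"
        proof (rule ccontr)
          assume "\<not> g e \<le> 0"
          moreover from e obtain ds where
            "set ds \<subseteq> {d \<in> ends M. g d > 0}" "walk M (endv M (mate M d)) ds (endv M e)"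
            by (auto simp: S_def R_def)
          ultimately have "endv M (mate M e) \<in> R"
            using e by (auto simp: R_def S_def walk_append intro!: exI[of _ "ds @ [e]"])
          then show False using e inv' by (auto simp: S_def)
        qed
      qed
      have "mate M d \<in> S - ?T" using mS nR inv'[OF d(1)] by (auto simp: S_def)
      moreover have "g (mate M d) < 0" using g(1) d by (auto simp: skew_def)
      ultimately show "\<exists>e\<in>S - ?T. g e < 0" by blast
    qed (use finS in auto)
    ultimately show False using 0 T0 by simp
  qed
  then show thesis using that by (auto simp: R_def)
qed

text \<open>
  A flow whose only value out of range becomes admissible modulo \<open>r\<close> is repaired by subtracting
  \<open>r\<close> along a positive directed closed trail through the bad edge.
\<close>

lemma repair_flow:
  assumes M: "wf_multipole M" "semiedges M = {}"
    and g: "skew M g" "\<forall>v\<in>verts M. outflow M g v = 0"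
    and b: "\<forall>e\<in>ends M - {d, mate M d}. 1 \<le> \<bar>g e\<bar> \<and> \<bar>g e\<bar> \<le> r - 1"
    and d: "d \<in> ends M" "g d > 0" "1 \<le> \<bar>g d - r\<bar>" "\<bar>g d - r\<bar> \<le> r - 1"
  obtains h where "end_flow M r h"
proof -
  have inv: "involutive M" using M(1) by (rule wf_imp_involutive)
  note inv' = involutiveD[OF inv]
  have fin: "finite (ends M)" using M(1) by (auto simp: wf_multipole_def)
  let ?A = "{d \<in> ends M. g d > 0}"
  obtain ds0 where "walk M (endv M (mate M d)) ds0 (endv M d)" "set ds0 \<subseteq> ?A"
    using positive_return_walk[OF M g d(1,2)] by blast
  then obtain ds where ds: "walk M (endv M (mate M d)) ds (endv M d)" "set ds \<subseteq> ?A" "distinct ds"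
    and min: "\<And>ds'. walk M (endv M (mate M d)) ds' (endv M d) \<Longrightarrow> set ds' \<subseteq> ?A \<Longrightarrow> length ds \<le> length ds'"
    by (rule walk_distinct_ends) blast
  \<comment> \<open>A visit to \<open>d\<close> would mean that the walk has already reached its
    goal \<open>endv M d\<close>, against minimality.\<close>
  have "d \<notin> set ds"
  proof
    assume "d \<in> set ds"
    then obtain xs zs where eq: "ds = xs @ d # zs" by (auto simp: in_set_conv_decomp)
    with ds have "walk M (endv M (mate M d)) xs (endv M d)" "set xs \<subseteq> ?A"
      by (auto simp: walk_append)
    from min[OF this] eq show False by simp
  qed
  let ?ds = "d # ds"
  have pos: "e \<in> ends M \<and> g e > 0" if "e \<in> set ?ds" for e
    using that d ds(2) by auto
  have sk: "g (mate M e) = - g e" if "e \<in> ends M" for e using g(1) that by (auto simp: skew_def)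
  \<comment> \<open>All traversed ends are positive, so no edge is traversed in both directions and
    the shift by \<open>r\<close> takes full effect on each.\<close>
  have neg: "mate M e \<notin> set ?ds" if "e \<in> set ?ds" for e
    using pos[OF that] pos[of "mate M e"] sk[of e] by linarith
  let ?h = "push M r ?ds g"
  have sh: "skew M ?h" using inv g(1) by (rule skew_push)
  have out: "outflow M ?h v = 0" if "v \<in> verts M" for v
  proof -
    have "outflow M ?h v =
      outflow M g v - (if endv M d = Some v then r else 0) + (if endv M d = Some v then r else 0)"
      by (rule outflow_push) (use inv fin ds \<open>d \<notin> set ds\<close> d in auto)
    then show ?thesis using g(2) that by simp
  qed
  have bd: "1 \<le> \<bar>?h e\<bar> \<and> \<bar>?h e\<bar> \<le> r - 1" if e: "e \<in> set ?ds" for e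
  proof -
    have "?h e = g e - r" using e neg[OF e] by (simp only: push_def if_True if_False)
    moreover have "1 \<le> \<bar>g e - r\<bar> \<and> \<bar>g e - r\<bar> \<le> r - 1"
    proof (cases "e = d")
      case False
      then have "e \<noteq> mate M d" using neg[of d] e by auto
      with False b pos[OF e] have "1 \<le> g e" "g e \<le> r - 1" by force+
      then show ?thesis by auto
    qed (use d in auto)
    ultimately show ?thesis by simp
  qed
  have "1 \<le> \<bar>?h e\<bar> \<and> \<bar>?h e\<bar> \<le> r - 1" if e: "e \<in> ends M" for e
  proof -
    consider "e \<in> set ?ds" | "mate M e \<in> set ?ds" | "e \<notin> set ?ds" "mate M e \<notin> set ?ds" by blast
    then show ?thesis
    proof cases
      case 2
      then show ?thesis using bd[OF 2] sh e by (auto simp: skew_def)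
    next
      case 3
      then have "?h e = g e" by (simp only: push_def if_False)
      moreover have "e \<noteq> d" "e \<noteq> mate M d" using 3 inv'[OF e] inv'[OF d(1)] by auto
      ultimately show ?thesis using b e by auto
    qed (rule bd)
  qed
  with sh out show thesis by (intro that) (auto simp: end_flow_def nz_skew_def)
qed

section \<open>Transmission through a decollineator and junctions\<close>

lemma make_pole_simps [simp]:
  "verts (make_pole M I J R) = verts M" "ends (make_pole M I J R) = ends M"
  "mate (make_pole M I J R) = mate M" "endv (make_pole M I J R) = endv M"
  "inp (make_pole M I J R) = I" "outp (make_pole M I J R) = J" "resid (make_pole M I J R) = R"
  by (simp_all add: make_pole_def multipole.defs pole.defs)

lemma detach_simps [simp]:
  "verts (detach M X E) = verts M - X" "ends (detach M X E) = ends M - \<Union>E"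
  "mate (detach M X E) = mate M"
  "endv (detach M X E) = (\<lambda>d. if endv M d \<in> Some ` X then None else endv M d)"
  by (simp_all add: detach_def)

lemma sum_abs_bound_2:
  assumes "card I = 2" "\<And>d. d \<in> I \<Longrightarrow> \<bar>g d\<bar> \<le> b"
  shows "\<bar>\<Sum>d\<in>I. g d\<bar> \<le> 2 * (b :: real)"
  using order_trans[OF sum_abs[of g I] sum_bounded_above[of I "\<lambda>d. \<bar>g d\<bar>" b]] assms
  by fastforce

text \<open>Conservation at \<open>u\<close> and \<open>v\<close> forces the value of the restored
  edge to be \<open>f\<close> up to sign. A total at distance at least 1 from 0, \<open>r\<close>
  and \<open>-r\<close> is either admissible or at least \<open>r + 1\<close> in absolute value;
  either way the forbidden flow arises, in the second case by \<open>repair_flow\<close>.\<close>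

lemma remove_path1_flow:
  fixes M :: "('v, 'd) multipole"
  assumes M: "cubic_graph M" and d: "path1 M d" and D: "D = remove_path1 M d" "pole_2_2 D"
    and g: "end_flow D r g" and r: "2 \<le> r" and no: "\<not> has_nowhere_zero_flow M r"
  shows "\<exists>n::int. \<bar>(\<Sum>e\<in>inp D. g e) - n * r\<bar> < 1"
proof (rule ccontr)
  assume far: "\<nexists>n::int. \<bar>(\<Sum>e\<in>inp D. g e) - n * r\<bar> < 1"
  define f where "f = (\<Sum>e\<in>inp D. g e)"
  have wf: "wf_multipole M" and nosemi: "semiedges M = {}"
    using M by (auto simp: cubic_graph_def cubic_multipole_def)
  have inv: "involutive M" using wf by (rule wf_imp_involutive)
  have fin: "finite (ends M)" using wf by (simp add: wf_multipole_def)
  have dM: "d \<in> ends M" using d by (simp add: path1_def)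
  note md = involutiveD[OF inv dM]
  obtain u where u: "u \<in> verts M" "endv M d = Some u" using M dM by (rule cubic_graph_endv)
  obtain v where v: "v \<in> verts M" "endv M (mate M d) = Some v" using M md(1) by (rule cubic_graph_endv)
  have uv: "u \<noteq> v" using d u v by (auto simp: path1_def)
  have D': "D = make_pole (detach M {u, v} {{d, mate M d}})
      (ends_at M u - {d, mate M d}) (ends_at M v - {d, mate M d}) {}"
    by (simp add: D(1) remove_path1_def u v edge_def)
  have I: "inp D = ends_at M u - {d}" and O: "outp D = ends_at M v - {mate M d}"
    using u v uv by (auto simp: D' ends_at_def)
  have IO: "inp D \<subseteq> - {d, mate M d}" "outp D \<subseteq> - {d, mate M d}"
    using u v uv by (auto simp: I O ends_at_def)
  have at: "ends_at D x = ends_at M x" if "x \<noteq> u" "x \<noteq> v" for x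
    using that u v by (auto simp: D' ends_at_def)
  have endsD: "ends D = ends M - {d, mate M d}" and mateD: "mate D = mate M" by (auto simp: D')
  have D2: "wf_multipole D" "semiedges D = inp D \<union> outp D" "inp D \<inter> outp D = {}" "card (inp D) = 2"
    using D(2) by (auto simp: pole_2_2_def cubic_multipole_def)
  have skD: "skew D g" and bD: "\<And>e. e \<in> ends D \<Longrightarrow> 1 \<le> \<bar>g e\<bar> \<and> \<bar>g e\<bar> \<le> r - 1"
    and KD: "\<forall>v\<in>verts D. outflow D g v = 0"
    using g by (auto simp: end_flow_def nz_skew_def)
  have finD: "finite (inp D)" "finite (outp D)" using fin by (auto simp: I O ends_at_def)
  have fo: "(\<Sum>e\<in>outp D. g e) = - f"
    using sum_semiedges[OF D2(1) skD KD] D2 finD by (simp add: sum.union_disjoint f_def)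
  \<comment> \<open>At \<open>u\<close> the input ends carry \<open>f\<close> in total, so
    \<open>d\<close> must carry \<open>-f\<close>; this also fits at \<open>v\<close>, where the
    output ends carry \<open>-f\<close>.\<close>
  define h where "h = g(d := - f, mate M d := f)"
  have hd: "h d = - f" "h (mate M d) = f" using md by (auto simp: h_def)
  have ho: "h e = g e" if "e \<notin> {d, mate M d}" for e using that by (simp add: h_def)
  have sk: "skew M h"
    unfolding skew_def
  proof
    fix e assume e: "e \<in> ends M"
    show "h (mate M e) = - h e"
    proof (cases "e \<in> {d, mate M d}")
      case True then show ?thesis using md hd by auto
    next
      case False
      then have "mate M e \<notin> {d, mate M d}" using md involutiveD[OF inv e] by auto
      then show ?thesis using False e skD ho by (auto simp: skew_def endsD mateD)
    qed
  qed
  have K: "\<forall>x\<in>verts M. outflow M h x = 0"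
  proof
    fix x assume x: "x \<in> verts M"
    have fx: "finite (ends_at M x)" using fin by (rule finite_ends_at)
    consider "x = u" | "x = v" | "x \<noteq> u" "x \<noteq> v" by blast
    then show "outflow M h x = 0"
    proof cases
      case 1
      have "outflow M h x = h d + (\<Sum>e\<in>inp D. h e)"
        unfolding outflow_def I 1 using fx u dM by (subst sum.remove[of _ d]) (auto simp: ends_at_def 1)
      also have "(\<Sum>e\<in>inp D. h e) = f"
        unfolding f_def by (rule sum.cong) (use IO in \<open>auto intro!: ho\<close>)
      finally show ?thesis using hd by simp
    next
      case 2
      have "outflow M h x = h (mate M d) + (\<Sum>e\<in>outp D. h e)"
        unfolding outflow_def O 2 using fx v md by (subst sum.remove[of _ "mate M d"]) (auto simp: ends_at_def 2)
      also have "(\<Sum>e\<in>outp D. h e) = - f"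
        unfolding fo[symmetric] by (rule sum.cong) (use IO in \<open>auto intro!: ho\<close>)
      finally show ?thesis using hd by simp
    next
      case 3
      have "outflow M h x = outflow D g x"
        unfolding outflow_def at[OF 3] by (rule sum.cong) (use u v 3 in \<open>auto intro!: ho simp: ends_at_def\<close>)
      then show ?thesis using KD x 3 by (auto simp: D')
    qed
  qed
  have b: "1 \<le> \<bar>h e\<bar> \<and> \<bar>h e\<bar> \<le> r - 1" if "e \<in> ends M - {d, mate M d}" for e
    using bD[of e] that ho[of e] by (auto simp: endsD)
  have no': "\<not> end_flow M r k" for k
    using no end_flow_imp_has_flow[OF inv fin, of r k] by blast
  have "\<not> (1 \<le> \<bar>f\<bar> \<and> \<bar>f\<bar> \<le> r - 1)"
  proof
    assume "1 \<le> \<bar>f\<bar> \<and> \<bar>f\<bar> \<le> r - 1"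
    then have "1 \<le> \<bar>h e\<bar> \<and> \<bar>h e\<bar> \<le> r - 1" if "e \<in> ends M" for e
      using b[of e] hd that by (cases "e \<in> {d, mate M d}") auto
    with sk K no' show False by (auto simp: end_flow_def nz_skew_def)
  qed
  \<comment> \<open>Two semiedges carry at most twice \<open>r - 1\<close>; after lowering by
    \<open>r\<close> at most \<open>r - 2\<close> is left.\<close>
  moreover have le: "\<bar>f\<bar> \<le> 2 * (r - 1)"
    unfolding f_def by (rule sum_abs_bound_2[OF D2(4)]) (use bD D2(2) in \<open>auto simp: semiedges_def\<close>)
  moreover have far': "\<not> \<bar>f - of_int n * r\<bar> < 1" for n :: int using far by (auto simp: f_def)
  moreover note far'[of 0] far'[of 1] far'[of "-1"]
  ultimately have "\<bar>f\<bar> \<ge> r + 1" using r by (auto simp: abs_if split: if_splits)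
  \<comment> \<open>\<open>repair_flow\<close> lowers a positive value, so the end of the restored
    edge that carries \<open>\<bar>f\<bar>\<close> is chosen.\<close>
  define e where "e = (if f > 0 then mate M d else d)"
  have e: "e \<in> ends M" "{e, mate M e} = {d, mate M d}" "h e = \<bar>f\<bar>"
    using dM md hd by (auto simp: e_def)
  obtain k where "end_flow M r k"
    by (rule repair_flow[OF wf nosemi sk K, of e r])
      (use b e le \<open>\<bar>f\<bar> \<ge> r + 1\<close> r in auto)
  with no' show False by blast
qed

section \<open>Junctions and the pull-back of flows through them\<close>

lemma junction_simps [simp]:
  "verts (junction p M) = verts M" "ends (junction p M) = ends M - {fst p, snd p}"
  "endv (junction p M) = endv M"
  "mate (junction p M) = (mate M)(mate M (fst p) := mate M (snd p), mate M (snd p) := mate M (fst p))"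
  by (auto simp: junction_def split: prod.split)

lemma junctions_simps [simp]:
  "verts (junctions ps M) = verts M" "endv (junctions ps M) = endv M"
  "ends (junctions ps M) = ends M - fst ` set ps - snd ` set ps"
  unfolding junctions_def by (induction ps arbitrary: M) auto

text \<open>If \<open>a\<close> and \<open>b\<close> are mates, the two updates concern only removed
  ends. Otherwise the former mates of \<open>a\<close> and \<open>b\<close> survive and become mates
  of each other, while all other pairs are untouched.\<close>

lemma involutive_junction:
  assumes "involutive M" "a \<in> ends M" "b \<in> ends M" "a \<noteq> b"
  shows "involutive (junction (a, b) M)"
proof -
  note i = involutiveD[OF assms(1)]
  note inj = involutive_mate_eq_iff[OF assms(1)]
  have "mate (junction (a, b) M) d \<in> ends (junction (a, b) M) \<and> mate (junction (a, b) M) d \<noteq> d \<and>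
      mate (junction (a, b) M) (mate (junction (a, b) M) d) = d"
    if "d \<in> ends (junction (a, b) M)" for d
  proof -
    have d: "d \<in> ends M" "d \<noteq> a" "d \<noteq> b" using that by auto
    show ?thesis
    proof (cases "d = mate M a \<or> d = mate M b")
      case True
      then show ?thesis using assms d i inj by auto
    next
      case False
      then have "mate M d \<noteq> a" "mate M d \<noteq> b" "mate M d \<noteq> mate M a" "mate M d \<noteq> mate M b"
        using d assms(2,3) i inj by auto
      then show ?thesis using False d i by auto
    qed
  qed
  then show ?thesis by (simp add: involutive_def)
qed

lemma wf_junctions:
  assumes "wf_multipole M" "distinct (map fst ps @ map snd ps)" "fst ` set ps \<union> snd ` set ps \<subseteq> ends M"
  shows "wf_multipole (junctions ps M)"
  using assms
proof (induction ps arbitrary: M)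
  case (Cons p ps)
  obtain a b where p: "p = (a, b)" by (cases p)
  have "involutive (junction (a, b) M)"
    using Cons.prems by (intro involutive_junction wf_imp_involutive) (auto simp: p)
  then have "wf_multipole (junction p M)"
    using Cons.prems(1) by (auto simp: wf_multipole_def involutive_def p)
  then have "wf_multipole (junctions ps (junction p M))"
    by (rule Cons.IH) (use Cons.prems in \<open>auto simp: p\<close>)
  then show ?case by (simp add: junctions_def)
qed (simp add: junctions_def)

text \<open>
  If \<open>a\<close> and \<open>b\<close> are the two ends of one edge, their junction is a circle without vertices, which
  the junction discards; it may carry any value, e.g. 1.
\<close>

lemma nz_skew_junction:
  assumes M: "involutive M" and ab: "a \<in> ends M" "b \<in> ends M" "a \<noteq> b"
    and g: "nz_skew (junction (a, b) M) r g" and r: "2 \<le> r"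
  obtains h where "nz_skew M r h" "\<And>d. d \<in> ends M - {a, b} \<Longrightarrow> h d = g d" "h b = - h a"
proof -
  note i = involutiveD[OF M]
  note inj = involutive_mate_eq_iff[OF M]
  have b: "1 \<le> \<bar>g d\<bar> \<and> \<bar>g d\<bar> \<le> r - 1"
    and sk: "g (mate (junction (a, b) M) d) = - g d" if "d \<in> ends M" "d \<noteq> a" "d \<noteq> b" for d
    using g that by (auto simp: nz_skew_def skew_def)
  have old: "g (mate M d) = - g d" if "d \<in> ends M" "d \<notin> {a, b, mate M a, mate M b}" for d
    using sk[of d] that by auto
  show thesis
  proof (cases "mate M a = b")
    case True
    then have ba: "mate M b = a" using i ab by auto
    let ?h = "g(a := 1, b := -1)"
    have "?h (mate M d) = - ?h d \<and> 1 \<le> \<bar>?h d\<bar> \<and> \<bar>?h d\<bar> \<le> r - 1" if d: "d \<in> ends M" for d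
    proof (cases "d \<in> {a, b}")
      case False
      then have "mate M d \<notin> {a, b}" using i[OF d] True ba by auto
      with False show ?thesis using old[OF d] b[OF d] True ba by auto
    qed (use True ba ab r in auto)
    then have "nz_skew M r ?h" by (simp add: nz_skew_def skew_def)
    then show thesis by (rule that) (use ab in auto)
  next
    case False
    then have ne: "mate M a \<noteq> b" "mate M b \<noteq> a" "mate M a \<noteq> mate M b" using i ab inj by auto
    \<comment> \<open>The merged edge is cut open: each half keeps its value, and the new free end
      gets the negative of its mate.\<close>
    let ?h = "g(a := - g (mate M a), b := - g (mate M b))"
    have gab: "g (mate M b) = - g (mate M a)"
      using sk[of "mate M a"] i ab ne by (auto split: if_splits)
    have bm: "1 \<le> \<bar>g (mate M a)\<bar> \<and> \<bar>g (mate M a)\<bar> \<le> r - 1"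
      "1 \<le> \<bar>g (mate M b)\<bar> \<and> \<bar>g (mate M b)\<bar> \<le> r - 1"
      using b[of "mate M a"] b[of "mate M b"] i ab ne by auto
    have "?h (mate M d) = - ?h d \<and> 1 \<le> \<bar>?h d\<bar> \<and> \<bar>?h d\<bar> \<le> r - 1" if d: "d \<in> ends M" for d
    proof -
      consider "d = a" | "d = b" | "d = mate M a" | "d = mate M b" | "d \<notin> {a, b, mate M a, mate M b}"
        by blast
      then show ?thesis
      proof cases
        case 5
        then have "mate M d \<notin> {a, b}" using i[OF d] i[OF ab(1)] i[OF ab(2)] by auto
        with 5 show ?thesis using old[OF d] b[OF d] by auto
      qed (use ne ab i bm in auto)
    qed
    then have "nz_skew M r ?h" by (simp add: nz_skew_def skew_def)
    then show thesis by (rule that) (use ab gab in auto)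
  qed
qed

text \<open>Undoes the junctions one at a time. The opposite values at the two ends of each pair are
  what later carries the total flow from one connector to the next.\<close>

lemma nz_skew_junctions:
  assumes "involutive M" "distinct (map fst ps @ map snd ps)" "fst ` set ps \<union> snd ` set ps \<subseteq> ends M"
    and "nz_skew (junctions ps M) r g" and "2 \<le> r"
  shows "\<exists>h. nz_skew M r h \<and> (\<forall>d\<in>ends (junctions ps M). h d = g d) \<and>
    (\<forall>p\<in>set ps. h (snd p) = - h (fst p))"
  using assms
proof (induction ps arbitrary: M)
  case Nil
  then show ?case by (auto simp: junctions_def)
next
  case (Cons p ps)
  obtain a b where p: "p = (a, b)" by (cases p)
  have ab: "a \<in> ends M" "b \<in> ends M" "a \<noteq> b" using Cons.prems by (auto simp: p)
  have inv: "involutive (junction p M)"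
    using Cons.prems(1) ab unfolding p by (rule involutive_junction)
  have eq: "junctions (p # ps) M = junctions ps (junction p M)" by (simp add: junctions_def)
  have sub: "fst ` set ps \<union> snd ` set ps \<subseteq> ends (junction p M)"
    using Cons.prems(2,3) by (auto simp: p)
  obtain h1 where h1: "nz_skew (junction p M) r h1"
    "\<forall>d\<in>ends (junctions ps (junction p M)). h1 d = g d"
    "\<forall>p\<in>set ps. h1 (snd p) = - h1 (fst p)"
    using Cons.IH[OF inv _ sub Cons.prems(4)[unfolded eq] Cons.prems(5)] Cons.prems(2) by auto
  obtain h where h: "nz_skew M r h" "\<And>d. d \<in> ends M - {a, b} \<Longrightarrow> h d = h1 d" "h b = - h a"
    using nz_skew_junction[OF Cons.prems(1) ab h1(1)[unfolded p] Cons.prems(5)] by blast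
  have "h d = g d" if "d \<in> ends (junctions (p # ps) M)" for d
    using h(2)[of d] h1(2) that by (auto simp: p)
  moreover have "h (snd q) = - h (fst q)" if q: "q \<in> set (p # ps)" for q
  proof (cases "q \<in> set ps")
    case True
    then have "fst q \<in> ends M - {a, b}" "snd q \<in> ends M - {a, b}"
      using Cons.prems(2,3) unfolding p by auto
    then have "h (fst q) = h1 (fst q)" "h (snd q) = h1 (snd q)" by (simp_all only: h(2))
    then show ?thesis using h1(3) True by simp
  next
    case False
    then have "q = (a, b)" using q by (auto simp: p)
    then show ?thesis using h(3) by simp
  qed
  ultimately show ?case using h(1) by blast
qed

text \<open>The values cancel pair by pair, whichever way of joining the connectors is
  chosen.\<close>

lemma connector_matching_sum:
  assumes "connector_matching J I ps" "\<forall>p\<in>set ps. h (snd p) = - h (fst p)"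
  shows "(\<Sum>d\<in>I. h d) = - (\<Sum>d\<in>J. h d :: real)"
proof -
  have "(\<Sum>d\<in>I. h d) = sum_list (map h (map snd ps))"
    using assms(1) sum_list_distinct_conv_sum_set[of "map snd ps" h] by (simp add: connector_matching_def)
  also have "map h (map snd ps) = map (\<lambda>p. - h (fst p)) ps"
    using assms(2) by simp
  also have "sum_list \<dots> = - sum_list (map h (map fst ps))"
    by (simp add: uminus_sum_list_map o_def)
  also have "sum_list (map h (map fst ps)) = (\<Sum>d\<in>J. h d)"
    using assms(1) sum_list_distinct_conv_sum_set[of "map fst ps" h] by (simp add: connector_matching_def)
  finally show ?thesis .
qed

section \<open>Halin fragments\<close>

lemma munion_simps [simp]:
  "verts (munion M N) = verts M \<union> verts N" "ends (munion M N) = ends M \<union> ends N"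
  by (simp_all add: munion_def)

lemma munion_left:
  assumes "d \<in> ends M"
  shows "mate (munion M N) d = mate M d" "endv (munion M N) d = endv M d"
  using assms by (simp_all add: munion_def)

lemma munion_right:
  assumes "disjoint_multipoles M N" "d \<in> ends N"
  shows "mate (munion M N) d = mate N d" "endv (munion M N) d = endv N d"
  using assms by (auto simp: munion_def disjoint_multipoles_def)

lemma wf_munion:
  assumes "wf_multipole M" "wf_multipole N" "disjoint_multipoles M N"
  shows "wf_multipole (munion M N)"
  using assms(1,2)
  by (auto simp: wf_multipole_def munion_left munion_right[OF assms(3)])

lemma semiedges_munion:
  assumes "disjoint_multipoles M N"
  shows "semiedges (munion M N) = semiedges M \<union> semiedges N"
  by (auto simp: semiedges_def munion_left munion_right[OF assms])

lemma ends_at_munion_left: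
  assumes "wf_multipole N" "disjoint_multipoles M N" "v \<in> verts M"
  shows "ends_at (munion M N) v = ends_at M v"
proof -
  have "endv N d \<noteq> Some v" if "d \<in> ends N" for d
    using assms that by (auto simp: disjoint_multipoles_def wf_multipole_def)
  then show ?thesis
    by (auto simp: ends_at_def munion_def)
qed

text \<open>Formulated without a removed path, so that it covers the bipartite poles as well as the
  fragments obtained from them by joins. The single residual semiedge makes \<open>the_elem\<close>
  meaningful.\<close>

definition pole_2_2_1 :: "('v, 'd) pole \<Rightarrow> bool" where
  "pole_2_2_1 M \<longleftrightarrow> wf_multipole M \<and> semiedges M = inp M \<union> outp M \<union> resid M \<and>
     inp M \<inter> outp M = {} \<and> inp M \<inter> resid M = {} \<and> outp M \<inter> resid M = {} \<and> card (resid M) = 1"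

text \<open>The three groups of semiedges come from distinct vertices, hence are disjoint;
  \<open>w\<close> has degree 3 and loses two ends to the path, which leaves one residual
  semiedge.\<close>

lemma bipartite_imp_pole_2_2_1:
  assumes "bipartite_2_2_1_pole B"
  shows "pole_2_2_1 B"
proof -
  obtain M d e where M: "cubic_graph M" and p: "path2 M d e" and B: "B = remove_path2 M d e"
    using assms by (auto simp: bipartite_2_2_1_pole_def)
  have wf: "wf_multipole M" and nosemi: "semiedges M = {}"
    using M by (auto simp: cubic_graph_def cubic_multipole_def)
  have inv: "involutive M" using wf by (rule wf_imp_involutive)
  have de: "d \<in> ends M" "e \<in> ends M" using p by (auto simp: path2_def)
  note md = involutiveD[OF inv de(1)] and me = involutiveD[OF inv de(2)]
  obtain u where u: "u \<in> verts M" "endv M d = Some u" using M de(1) by (rule cubic_graph_endv)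
  obtain w where w: "w \<in> verts M" "endv M e = Some w" using M de(2) by (rule cubic_graph_endv)
  obtain v where v: "v \<in> verts M" "endv M (mate M e) = Some v" using M me(1) by (rule cubic_graph_endv)
  have mdw: "endv M (mate M d) = Some w" and ne: "u \<noteq> w" "u \<noteq> v" "w \<noteq> v"
    using p u w v by (auto simp: path2_def)
  have B': "B = make_pole (detach M {u, w, v} {{d, mate M d}, {e, mate M e}})
      (ends_at M u - {d, mate M d, e, mate M e}) (ends_at M v - {d, mate M d, e, mate M e})
      (ends_at M w - {d, mate M d, e, mate M e})"
    by (simp add: B remove_path2_def u v w edge_def Un_commute insert_commute)
  have "wf_multipole B"
    using wf involutive_mate_eq_iff[OF inv] md me de
    by (auto simp: B' wf_multipole_def split: if_splits)
  moreover have "semiedges B = inp B \<union> outp B \<union> resid B"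
    using nosemi by (auto simp: B' semiedges_def ends_at_def split: if_splits)
  moreover have "card (resid B) = 1"
  proof -
    have "resid B = ends_at M w - {mate M d, e}"
      using u v w ne by (auto simp: B' ends_at_def)
    moreover have "{mate M d, e} \<subseteq> ends_at M w" "mate M d \<noteq> e"
      using md de mdw w v u ne by (auto simp: ends_at_def)
    moreover have "card (ends_at M w) = 3"
      using M w by (auto simp: cubic_graph_def cubic_multipole_def degree_def)
    ultimately show ?thesis by (simp add: card_Diff_subset)
  qed
  moreover have "inp B \<inter> outp B = {}" "inp B \<inter> resid B = {}" "outp B \<inter> resid B = {}"
    using ne by (auto simp: B' ends_at_def)
  ultimately show ?thesis by (simp add: pole_2_2_1_def)
qed

lemma connector_matching_distinct:
  assumes "connector_matching J I ps" "J \<inter> I = {}"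
  shows "distinct (map fst ps @ map snd ps)"
  using assms by (auto simp: connector_matching_def)

lemma connector_matching_sets:
  assumes "connector_matching J I ps"
  shows "fst ` set ps = J" "snd ` set ps = I"
  using assms by (auto simp: connector_matching_def)

lemma is_join_decompose:
  assumes D: "pole_2_2 D" and B: "pole_2_2_1 B" and F: "is_join D B F"
  obtains ps where "connector_matching (outp D) (inp B) ps" "disjoint_multipoles D B"
    "outp D \<subseteq> ends D" "inp B \<subseteq> ends B" "distinct (map fst ps @ map snd ps)"
    "F = make_pole (junctions ps (munion D B)) (inp D) (outp B) (resid B)"
proof -
  obtain ps where ps: "disjoint_multipoles D B" "connector_matching (outp D) (inp B) ps"
    "F = make_pole (junctions ps (munion D B)) (inp D) (outp B) (resid D \<union> resid B)"
    using F by (auto simp: is_join_def)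
  have sub: "outp D \<subseteq> ends D" "inp B \<subseteq> ends B"
    using D B by (auto simp: pole_2_2_def pole_2_2_1_def semiedges_def)
  then have "outp D \<inter> inp B = {}" using ps(1) by (auto simp: disjoint_multipoles_def)
  from connector_matching_distinct[OF ps(2) this] show thesis
    by (rule that[OF ps(2,1) sub]) (use ps(3) D in \<open>simp add: pole_2_2_def\<close>)
qed

lemma is_join_pole_2_2_1:
  assumes D: "pole_2_2 D" and B: "pole_2_2_1 B" and F: "is_join D B F"
  shows "pole_2_2_1 F" "inp F = inp D"
proof -
  obtain ps where ps: "connector_matching (outp D) (inp B) ps" "disjoint_multipoles D B"
    "outp D \<subseteq> ends D" "inp B \<subseteq> ends B" "distinct (map fst ps @ map snd ps)"
    "F = make_pole (junctions ps (munion D B)) (inp D) (outp B) (resid B)"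
    by (rule is_join_decompose[OF assms])
  note sets = connector_matching_sets[OF ps(1)]
  have D': "wf_multipole D" "semiedges D = inp D \<union> outp D" "inp D \<inter> outp D = {}"
    using D by (auto simp: pole_2_2_def cubic_multipole_def)
  have B': "wf_multipole B" "semiedges B = inp B \<union> outp B \<union> resid B" "inp B \<inter> outp B = {}"
    "inp B \<inter> resid B = {}" "outp B \<inter> resid B = {}" "card (resid B) = 1"
    using B by (auto simp: pole_2_2_1_def)
  have dis: "(inp D \<union> outp D) \<inter> (inp B \<union> outp B \<union> resid B) = {}"
    using ps(2) unfolding D'(2)[symmetric] B'(2)[symmetric]
    by (auto simp: disjoint_multipoles_def semiedges_def)
  have "wf_multipole (junctions ps (munion D B))"
    by (rule wf_junctions) (use D' B' ps sets in \<open>auto intro: wf_munion\<close>)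
  then have "wf_multipole F" by (simp add: ps(6) wf_multipole_def)
  moreover have "semiedges F = semiedges (munion D B) - outp D - inp B"
    by (auto simp: ps(6) semiedges_def sets)
  ultimately show "pole_2_2_1 F"
    using D' B' dis by (auto simp: pole_2_2_1_def ps(6) semiedges_munion[OF ps(2)])
  show "inp F = inp D" by (simp add: ps(6))
qed

text \<open>The flow is pulled back to the disjoint union and restricted to \<open>D\<close>. Only
  ends in \<open>outp D\<close> get new values, and these are free, so conservation at the vertices
  of \<open>D\<close> persists.\<close>

lemma is_join_flow:
  assumes D: "pole_2_2 D" and B: "pole_2_2_1 B" and F: "is_join D B F"
    and g: "end_flow F r g" and r: "2 \<le> r"
  obtains h where "end_flow D r h" "\<And>d. d \<in> inp D \<Longrightarrow> h d = g d"
proof -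
  obtain ps where ps: "connector_matching (outp D) (inp B) ps" "disjoint_multipoles D B"
    "outp D \<subseteq> ends D" "inp B \<subseteq> ends B" "distinct (map fst ps @ map snd ps)"
    "F = make_pole (junctions ps (munion D B)) (inp D) (outp B) (resid B)"
    by (rule is_join_decompose[OF D B F])
  note sets = connector_matching_sets[OF ps(1)]
  have D': "wf_multipole D" "semiedges D = inp D \<union> outp D" "inp D \<inter> outp D = {}"
    using D by (auto simp: pole_2_2_def cubic_multipole_def)
  have B': "wf_multipole B" "semiedges B = inp B \<union> outp B \<union> resid B"
    using B by (auto simp: pole_2_2_1_def)
  have inp_D: "inp D \<subseteq> ends D"
    and free_D: "\<And>d. d \<in> outp D \<Longrightarrow> d \<in> ends D \<and> endv D d = None"
    and free_B: "\<And>d. d \<in> inp B \<Longrightarrow> d \<in> ends B \<and> endv B d = None"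
    using D'(2) B'(2) unfolding semiedges_def by blast+
  let ?M = "munion D B"
  have sub: "fst ` set ps \<union> snd ` set ps \<subseteq> ends ?M" using ps(3,4) sets by auto
  have "nz_skew (junctions ps ?M) r g"
    using g by (simp add: end_flow_def nz_skew_def skew_def ps(6))
  then obtain h where h: "nz_skew ?M r h" "\<forall>d\<in>ends (junctions ps ?M). h d = g d"
    using nz_skew_junctions[OF wf_imp_involutive[OF wf_munion[OF D'(1) B'(1) ps(2)]] ps(5) sub _ r]
    by blast
  have hg: "h d = g d" if "d \<in> ends D" "d \<notin> outp D" for d
    using that h(2) ps(2,4) sets by (auto simp: disjoint_multipoles_def)
  have "outflow D h v = 0" if v: "v \<in> verts D" for v
  proof -
    have free: "endv ?M d = None" if "d \<in> outp D \<union> inp B" for d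
      using that free_D free_B munion_left(2)[of d D B] munion_right(2)[OF ps(2), of d] by auto
    have "ends_at F v = {d \<in> ends ?M - (outp D \<union> inp B). endv ?M d = Some v}"
      by (auto simp: ps(6) ends_at_def sets)
    also have "\<dots> = ends_at ?M v"
      unfolding ends_at_def using free by force
    also have "\<dots> = ends_at D v" by (rule ends_at_munion_left[OF B'(1) ps(2) v])
    finally have eq: "ends_at F v = ends_at D v" .
    have "outflow D h v = outflow F g v"
      unfolding outflow_def eq
      by (rule sum.cong) (use free_D in \<open>auto simp: ends_at_def intro!: hg\<close>)
    then show ?thesis using g v by (simp add: end_flow_def ps(6))
  qed
  moreover have "h (mate D d) = - h d" if "d \<in> ends D" for d
  proof -
    have "h (mate ?M d) = - h d" using h(1) that by (simp add: nz_skew_def skew_def)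
    then show ?thesis by (simp add: munion_left that)
  qed
  then have "nz_skew D r h"
    using h(1) by (simp add: nz_skew_def skew_def)
  ultimately have "end_flow D r h" by (simp add: end_flow_def)
  then show thesis
    by (rule that) (use D'(3) inp_D in \<open>auto intro!: hg\<close>)
qed

text \<open>This is \<open>sum_semiedges\<close> sorted by connector; it expresses the residual
  value by the totals on the two connectors.\<close>

lemma pole_2_2_1_sum:
  assumes F: "pole_2_2_1 F" and g: "end_flow F r g"
  shows "(\<Sum>d\<in>inp F. g d) + (\<Sum>d\<in>outp F. g d) + g (the_elem (resid F)) = 0"
proof -
  have F': "wf_multipole F" "semiedges F = inp F \<union> outp F \<union> resid F" "inp F \<inter> outp F = {}"
    "inp F \<inter> resid F = {}" "outp F \<inter> resid F = {}" "card (resid F) = 1"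
    using F by (auto simp: pole_2_2_1_def)
  obtain x where x: "resid F = {x}" using F'(6) by (rule card_1_singletonE)
  have "finite (semiedges F)" using F'(1) by (simp add: wf_multipole_def semiedges_def)
  then have fin: "finite (inp F)" "finite (outp F)" by (auto simp: F'(2))
  have "0 = (\<Sum>d\<in>semiedges F. g d)"
    using sum_semiedges[OF F'(1)] g by (auto simp: end_flow_def nz_skew_def)
  also have "\<dots> = (\<Sum>d\<in>inp F \<union> outp F. g d) + g x"
    unfolding F'(2) x using fin F' x by (subst sum.union_disjoint) auto
  also have "(\<Sum>d\<in>inp F \<union> outp F. g d) = (\<Sum>d\<in>inp F. g d) + (\<Sum>d\<in>outp F. g d)"
    using fin F' by (subst sum.union_disjoint) auto
  finally show ?thesis by (simp add: x)
qed

text \<open>Subtracting suitable multiples of \<open>r\<close> moves \<open>a\<close>,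
  \<open>b\<close>, \<open>c\<close> into the open interval from -1 to 1, and the hypotheses keep
  them pairwise at distance at least 1. An open interval of length 2 has no room for three such
  points.\<close>

lemma three_differences:
  fixes a b c r :: real and l m n :: int
  assumes "\<And>n::int. \<bar>a - b - n * r\<bar> \<ge> 1" "\<And>n::int. \<bar>b - c - n * r\<bar> \<ge> 1"
    "\<And>n::int. \<bar>c - a - n * r\<bar> \<ge> 1"
    and "\<bar>a - l * r\<bar> < 1" "\<bar>b - m * r\<bar> < 1" "\<bar>c - n * r\<bar> < 1"
  shows False
proof -
  define a' b' c' where "a' = a - l * r" and "b' = b - m * r" and "c' = c - n * r"
  have "1 \<le> \<bar>a' - b'\<bar>" "1 \<le> \<bar>b' - c'\<bar>" "1 \<le> \<bar>c' - a'\<bar>"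
    using assms(1)[of "l - m"] assms(2)[of "m - n"] assms(3)[of "n - l"]
    by (auto simp: a'_def b'_def c'_def algebra_simps)
  then have "a' - b' \<ge> 1 \<or> a' - b' \<le> -1" "b' - c' \<ge> 1 \<or> b' - c' \<le> -1" "c' - a' \<ge> 1 \<or> c' - a' \<le> -1"
    by linarith+
  moreover have "a' < 1 \<and> -1 < a'" "b' < 1 \<and> -1 < b'" "c' < 1 \<and> -1 < c'"
    using assms(4-6) by (simp_all add: a'_def b'_def c'_def abs_less_iff)
  ultimately show False by linarith
qed

section \<open>Two leaves with a common neighbour\<close>

lemma walk_nth:
  assumes "walk M x C y" "i < length C"
  shows "endv M (mate M (C ! i)) = (if Suc i < length C then endv M (C ! Suc i) else y)"
  using assms
proof (induction C arbitrary: x i)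
  case (Cons d C)
  show ?case
  proof (cases i)
    case 0
    then show ?thesis using Cons.prems by (cases C) auto
  next
    case (Suc n)
    then show ?thesis using Cons by auto
  qed
qed simp

lemma walk_verts:
  "walk M x ds y \<Longrightarrow> x # map (\<lambda>d. endv M (mate M d)) ds = map (endv M) ds @ [y]"
  by (induction ds arbitrary: x) auto

definition spath ::
    "('v, 'd) multipole \<Rightarrow> 'v option \<Rightarrow> 'd list \<Rightarrow> 'v option \<Rightarrow> bool" where
  "spath M x ds y \<longleftrightarrow> walk M x ds y \<and> set ds \<subseteq> ends M \<and>
     distinct (x # map (\<lambda>d. endv M (mate M d)) ds)"

lemma spath_Nil [simp]: "spath M x [] y \<longleftrightarrow> x = y"
  by (auto simp: spath_def)

lemma spath_Cons:
  "spath M x (d # ds) y \<longleftrightarrow> d \<in> ends M \<and> endv M d = x \<and> spath M (endv M (mate M d)) ds y \<and>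
     x \<notin> set (endv M (mate M d) # map (\<lambda>d. endv M (mate M d)) ds)"
  by (auto simp: spath_def)

lemma spath_initials: "spath M x ds y \<Longrightarrow> distinct (map (endv M) ds @ [y])"
  by (metis spath_def walk_verts)

lemma edge_eqD: "edge M d = edge M e \<Longrightarrow> d = e \<or> d = mate M e"
  by (auto simp: edge_def)

lemma spath_ends_on_path:
  assumes "spath M x ds y" "d \<in> set ds"
  shows "endv M d \<in> set (x # map (\<lambda>d. endv M (mate M d)) ds)"
    "endv M (mate M d) \<in> set (x # map (\<lambda>d. endv M (mate M d)) ds)"
proof -
  have "x # map (\<lambda>d. endv M (mate M d)) ds = map (endv M) ds @ [y]"
    using assms(1) walk_verts by (auto simp: spath_def)
  moreover have "endv M d \<in> set (map (endv M) ds @ [y])" using assms(2) by simp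
  ultimately show "endv M d \<in> set (x # map (\<lambda>d. endv M (mate M d)) ds)" by simp
qed (use assms in auto)

text \<open>An edge at \<open>x\<close> that is also used after the first step would put
  \<open>x\<close> on the rest of the path.\<close>

lemma spath_edges:
  assumes "involutive M" "spath M x (d # ds) y" "e \<in> ends M" "endv M e = x" "e' \<in> set ds"
  shows "edge M e \<noteq> edge M e'"
proof
  assume eq: "edge M e = edge M e'"
  have "spath M (endv M (mate M d)) ds y"
    and n: "x \<notin> set (endv M (mate M d) # map (\<lambda>d. endv M (mate M d)) ds)"
    using assms(2) by (auto simp: spath_Cons)
  from spath_ends_on_path[OF this(1) assms(5)] n edge_eqD[OF eq] assms(4) show False
    by auto
qed

lemma distinct_edges_spath:
  assumes "involutive M" "spath M x ds y"
  shows "distinct (map (edge M) ds)"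
  using assms(2)
proof (induction ds arbitrary: x)
  case (Cons d ds)
  have "edge M d \<noteq> edge M e" if "e \<in> set ds" for e
    by (rule spath_edges[OF assms(1) Cons.prems]) (use Cons.prems that in \<open>auto simp: spath_Cons\<close>)
  with Cons show ?case by (auto simp: spath_Cons)
qed simp

lemma circuit_closed_walk:
  assumes "walk M x C x" "C \<noteq> []" "set C \<subseteq> ends M" "\<forall>d\<in>ends M. endv M d \<noteq> None"
    "distinct (map (endv M) C)" "distinct (map (edge M) C)"
  shows "circuit M C"
  unfolding circuit_def
proof (intro conjI allI impI)
  fix i assume i: "i < length C"
  show "endv M (C ! i) \<noteq> None" using assms i by (meson nth_mem subsetD)
  have x: "endv M (C ! 0) = x" using assms(1,2) by (cases C) auto
  show "endv M (mate M (C ! i)) = endv M (C ! (Suc i mod length C))"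
  proof (cases "Suc i < length C")
    case False
    then have "Suc i = length C" using i by simp
    then show ?thesis using walk_nth[OF assms(1) i] x by simp
  qed (use walk_nth[OF assms(1) i] in simp)
qed (use assms in auto)

text \<open>If the new vertex \<open>?z\<close> were already on the path, the part of the path up to
  \<open>?z\<close> would form a circuit together with \<open>e\<close>. The assumption
  \<open>ne\<close> excludes turning back along the first edge, since an edge traversed twice gives
  no circuit.\<close>

lemma spath_extend:
  assumes M: "involutive M" "\<forall>d\<in>ends M. endv M d \<noteq> None" and acyc: "\<nexists>C. circuit M C"
    and ds: "spath M x ds y" and e: "e \<in> ends M" "endv M e = x"
    and ne: "ds \<noteq> [] \<Longrightarrow> edge M e \<noteq> edge M (hd ds)"
  shows "spath M (endv M (mate M e)) (mate M e # ds) y"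
proof -
  note me = involutiveD[OF M(1) e(1)]
  let ?z = "endv M (mate M e)"
  have "?z \<notin> set (x # map (\<lambda>d. endv M (mate M d)) ds)"
  proof
    assume z: "?z \<in> set (x # map (\<lambda>d. endv M (mate M d)) ds)"
    have "circuit M [e]" if "?z = x"
      by (rule circuit_closed_walk[of _ x]) (use that e M(2) in auto)
    then have "?z \<noteq> x" using acyc by blast
    then obtain d where "d \<in> set ds" "?z = endv M (mate M d)" using z by auto
    then obtain ds1 ds2 where split: "ds = (ds1 @ [d]) @ ds2" by (auto simp: in_set_conv_decomp)
    let ?C = "ds1 @ [d]"
    have w: "walk M x ?C ?z"
      using ds \<open>?z = endv M (mate M d)\<close> unfolding split spath_def by (auto simp: walk_append)
    have sp: "spath M x ?C ?z" using ds w unfolding split spath_def by auto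
    have "distinct (map (endv M) ?C @ [?z])"
      using sp unfolding spath_def walk_verts[OF w] by blast
    moreover have "edge M (mate M e) \<noteq> edge M d'" if d': "d' \<in> set ?C" for d'
    proof -
      obtain d1 rest where C: "?C = d1 # rest" by (cases ?C) auto
      have "hd ds = d1" "ds \<noteq> []" using C unfolding split by auto
      show ?thesis
        using spath_edges[OF M(1) sp[unfolded C] e(1,2), of d'] d' ne \<open>hd ds = d1\<close> \<open>ds \<noteq> []\<close>
        unfolding C by (auto simp: edge_mate[OF M(1) e(1)])
    qed
    ultimately have "circuit M (mate M e # ?C)"
      using w e me sp distinct_edges_spath[OF M(1) sp] M(2)
      by (intro circuit_closed_walk[of _ ?z]) (auto simp: spath_def)
    then show False using acyc by blast
  qed
  then show ?thesis using ds e me by (simp add: spath_Cons)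
qed

lemma degree_3_third:
  assumes "degree M v = 3"
  obtains e where "e \<in> ends_at M v" "e \<noteq> c" "e \<noteq> d"
proof -
  have "card {c, d} < card (ends_at M v)"
    using assms card_insert_le_m1[of 2 "{d}" c] by (simp add: degree_def)
  then have "\<not> ends_at M v \<subseteq> {c, d}" by (meson card_mono finite.emptyI finite_insert not_le)
  then show thesis using that by blast
qed

text \<open>Take a longest path. Its first vertex \<open>x\<close> is a leaf, since otherwise a
  further edge at \<open>x\<close> would prolong it. Its second vertex \<open>w\<close> has a third
  edge, to a vertex \<open>y\<close>; replacing \<open>x\<close> by \<open>y\<close> gives a path of
  the same length, so \<open>y\<close> is a leaf too.\<close>

lemma tree_cherry:
  fixes S :: "('v, 'd) multipole"
  assumes wf: "wf_multipole S" and nosemi: "semiedges S = {}" and acyc: "\<nexists>C. circuit S C"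
    and deg: "\<forall>v\<in>verts S. degree S v \<in> {1, 3}" and inner: "\<exists>v\<in>verts S. degree S v = 3"
  obtains w x y a b where "w \<in> verts S" "degree S w = 3" "a \<in> ends_at S w" "b \<in> ends_at S w"
    "a \<noteq> b" "endv S (mate S a) = Some x" "endv S (mate S b) = Some y"
    "x \<in> verts S" "y \<in> verts S" "degree S x = 1" "degree S y = 1" "x \<noteq> y"
proof -
  have inv: "involutive S" using wf by (rule wf_imp_involutive)
  note i = involutiveD[OF inv]
  have fin: "finite (ends S)" using wf by (simp add: wf_multipole_def)
  have vert: "\<exists>v. endv S d = Some v \<and> v \<in> verts S" if "d \<in> ends S" for d
    using that wf nosemi by (auto simp: wf_multipole_def semiedges_def)
  have some: "\<forall>d\<in>ends S. endv S d \<noteq> None" using vert by force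
  note extend = spath_extend[OF inv some acyc]
  have len: "length ds < Suc (card (ends S))" if "spath S x ds y" for x ds y
  proof -
    have "distinct ds" "set ds \<subseteq> ends S" using that by (auto simp: spath_def distinct_map)
    then show ?thesis using fin by (metis card_mono distinct_card less_Suc_eq_le)
  qed
  \<comment> \<open>A path with two edges through an inner vertex exists, so \<open>w\<close> is not
    the last vertex of a longest path and has degree at least 2.\<close>
  obtain q where q: "q \<in> verts S" "degree S q = 3" using inner by blast
  obtain b0 where b0: "b0 \<in> ends_at S q" by (rule degree_3_third[OF q(2)])
  obtain a0 where a0: "a0 \<in> ends_at S q" "a0 \<noteq> b0" "a0 \<noteq> mate S b0"
    by (rule degree_3_third[OF q(2)])
  have 1: "spath S (Some q) [b0] (endv S (mate S b0))"
    using extend[of "endv S (mate S b0)" "[]" "endv S (mate S b0)" "mate S b0"] b0 i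
    by (auto simp: ends_at_def)
  have 2: "spath S (endv S (mate S a0)) [mate S a0, b0] (endv S (mate S b0))"
    by (rule extend[OF 1]) (use a0 b0 in \<open>auto simp: ends_at_def dest: edge_eqD\<close>)
  define P where "P ds \<longleftrightarrow> (\<exists>x y. spath S x ds y)" for ds
  define ds where "ds = arg_max length P"
  have Pds: "P ds" and max: "\<And>es. P es \<Longrightarrow> length es \<le> length ds"
    using arg_max_nat_lemma[of P "[mate S a0, b0]" length "Suc (card (ends S))"] 2 len
    unfolding ds_def P_def by blast+
  \<comment> \<open>Stated for every path of maximal length, because it serves both the longest path
    and the one with \<open>y\<close> in place of \<open>x\<close>.\<close>
  have leaf: "degree S v = 1" if es: "spath S (Some v) (d # es) y" "length (d # es) = length ds" for v d es y
  proof (rule ccontr)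
    assume n1: "degree S v \<noteq> 1"
    have d: "d \<in> ends S" "endv S d = Some v" using es by (auto simp: spath_Cons)
    then have "v \<in> verts S" using vert by force
    then have "degree S v = 3" using deg n1 by blast
    then obtain e where e: "e \<in> ends_at S v" "e \<noteq> d" "e \<noteq> mate S d" by (rule degree_3_third)
    then have "spath S (endv S (mate S e)) (mate S e # d # es) y"
      by (intro extend[OF es(1)]) (auto simp: ends_at_def dest: edge_eqD)
    then have "P (mate S e # d # es)" by (auto simp: P_def)
    from max[OF this] es(2) show False by simp
  qed
  have "P [mate S a0, b0]" using 2 unfolding P_def by blast
  then have "length ds \<ge> 2" using max by force
  then obtain d c rest where ds: "ds = d # c # rest"
    by (cases ds; cases "tl ds") (auto simp: neq_Nil_conv)
  obtain x0 y0 where sp: "spath S x0 ds y0" using Pds by (auto simp: P_def)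
  have d: "d \<in> ends S" "endv S d = x0" and sp1: "spath S (endv S (mate S d)) (c # rest) y0"
    using sp by (auto simp: ds spath_Cons)
  note md = i[OF d(1)]
  obtain x where x: "x0 = Some x" "x \<in> verts S" using vert[OF d(1)] d(2) by auto
  obtain w where w: "endv S (mate S d) = Some w" "w \<in> verts S" using vert[OF md(1)] by auto
  have degx: "degree S x = 1" using leaf[of x d "c # rest" y0] sp x by (simp add: ds)
  have c: "c \<in> ends S" "endv S c = Some w" using sp1 w by (auto simp: spath_Cons)
  have "c \<noteq> mate S d"
    using distinct_edges_spath[OF inv sp] edge_mate[OF inv d(1)] by (auto simp: ds)
  moreover have "{mate S d, c} \<subseteq> ends_at S w" using w c md by (auto simp: ends_at_def)
  moreover have "finite (ends_at S w)" using fin by (rule finite_ends_at)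
  ultimately have "degree S w \<noteq> 1"
    unfolding degree_def by (metis card_1_singletonE insert_subset singletonD)
  then have degw: "degree S w = 3" using deg w by blast
  obtain e where e: "e \<in> ends_at S w" "e \<noteq> mate S d" "e \<noteq> c" by (rule degree_3_third[OF degw])
  have eS: "e \<in> ends S" "endv S e = Some w" using e by (auto simp: ends_at_def)
  obtain y where y: "endv S (mate S e) = Some y" "y \<in> verts S" using vert[OF i(1)[OF eS(1)]] by auto
  \<comment> \<open>As \<open>e\<close> differs from \<open>c\<close>, the two could share their
    edge only if it were a loop at \<open>w\<close>.\<close>
  have "edge S e \<noteq> edge S c"
  proof
    assume "edge S e = edge S c"
    then have "endv S (mate S c) = Some w" using e eS edge_eqD[of S e c] by auto
    then show False using sp1 w by (auto simp: spath_Cons)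
  qed
  then have "spath S (Some y) (mate S e # c # rest) y0"
    using extend[OF sp1[unfolded w(1)] eS] y by simp
  then have degy: "degree S y = 1" by (rule leaf) (simp add: ds)
  have "x \<noteq> y"
  proof
    assume "x = y"
    then have "{d, mate S e} \<subseteq> ends_at S x" using d x y i[OF eS(1)] by (auto simp: ends_at_def)
    then have "mate S e = d" using degx unfolding degree_def by (metis card_1_singletonE insert_subset singletonD)
    then show False using e i[OF eS(1)] by auto
  qed
  show thesis
    by (rule that[of w "mate S d" e x y])
      (use w degw e md d x y degx degy \<open>x \<noteq> y\<close> in \<open>auto simp: ends_at_def\<close>)
qed

section \<open>Chords of the outer circuit\<close>

text \<open>\<open>outside K\<close> is unbounded and misses the curve, so it meets the unbounded
  side of the curve. That side is connected and avoids the frontier of \<open>outside K\<close>, so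
  it is contained in \<open>outside K\<close>. For a drawing this means that it stays in the closed
  disc bounded by the outer circuit.\<close>

lemma frontier_outside_eq_curve:
  fixes K :: "complex set"
  assumes J: "simple_path J" "pathfinish J = pathstart J" and K: "compact K"
    and fr: "frontier (outside K) = path_image J"
  shows "K \<inter> outside (path_image J) = {}"
proof -
  let ?G = "path_image J" and ?O = "outside K"
  note jordan = Jordan_inside_outside[OF J]
  have "open ?O" using K by (simp add: compact_imp_closed open_outside)
  then have disj: "?O \<inter> ?G = {}" unfolding fr[symmetric] using frontier_disjoint_eq[of ?O] by blast
  have "\<not> bounded ?O" using K by (simp add: compact_imp_bounded unbounded_outside)
  moreover have "bounded (inside ?G)" and Un: "inside ?G \<union> outside ?G = - ?G" and con: "connected (outside ?G)"
    using jordan by blast+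
  ultimately have "\<not> ?O \<subseteq> inside ?G" using bounded_subset by blast
  then have "outside ?G \<inter> ?O \<noteq> {}" using disj Un by blast
  moreover have "outside ?G \<inter> frontier ?O = {}" unfolding fr by (rule outside_no_overlap)
  ultimately have "outside ?G \<subseteq> ?O"
    using connected_Int_frontier[OF con, of ?O] by blast
  then show ?thesis using outside_no_overlap[of K] by blast
qed

text \<open>The chord \<open>c\<close> divides the inside into two regions. \<open>V1\<close> and
  \<open>V2\<close> are these regions enlarged by the parts of the boundary arcs off the chord, so
  that points on the closed curve also have a side. The last claim is about closures because an edge
  without its endpoints is placed first, and its endpoints, possibly on the curve, follow.\<close>

lemma theta_sides:
  fixes c :: "real \<Rightarrow> complex"
  assumes arcs: "arc c1" "arc c2" "arc c"
    and st: "pathstart c1 = p" "pathfinish c1 = q" "pathstart c2 = p" "pathfinish c2 = q"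
      "pathstart c = p" "pathfinish c = q"
    and int: "path_image c1 \<inter> path_image c2 = {p, q}" "path_image c1 \<inter> path_image c = {p, q}"
      "path_image c2 \<inter> path_image c = {p, q}"
    and ne: "path_image c \<inter> inside (path_image c1 \<union> path_image c2) \<noteq> {}"
  obtains V1 V2 where "V1 \<inter> V2 = {}"
    "inside (path_image c1 \<union> path_image c2) \<union> path_image c1 \<union> path_image c2 - path_image c \<subseteq> V1 \<union> V2"
    "path_image c1 - path_image c \<subseteq> V1" "path_image c2 - path_image c \<subseteq> V2"
    "\<And>K. connected K \<Longrightarrow> K \<subseteq> inside (path_image c1 \<union> path_image c2) - path_image c \<Longrightarrow>
       closure K - path_image c \<subseteq> V1 \<or> closure K - path_image c \<subseteq> V2"
proof -
  let ?c = "path_image c" and ?c1 = "path_image c1" and ?c2 = "path_image c2"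
  let ?I = "inside (?c1 \<union> ?c2)"
  let ?U1 = "inside (?c1 \<union> ?c)" and ?U2 = "inside (?c2 \<union> ?c)"
  have "p \<noteq> q" using arc_distinct_ends[OF arcs(1)] st by auto
  have "?U1 \<inter> ?U2 = {} \<and> ?U1 \<union> ?U2 \<union> (?c - {p, q}) = ?I"
  proof (rule split_inside_simple_closed_curve)
    show "simple_path c1" "simple_path c2" "simple_path c"
      using arcs by (simp_all add: arc_imp_simple_path)
  qed (fact st int ne \<open>p \<noteq> q\<close> | blast)+
  then have split: "?U1 \<inter> ?U2 = {}" "?U1 \<union> ?U2 \<union> (?c - {p, q}) = ?I" by blast+
  have closed: "closed (?c1 \<union> ?c)" "closed (?c2 \<union> ?c)"
    using arcs by (simp_all add: closed_Un closed_arc_image)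
  have cl: "closure ?U1 \<subseteq> ?c1 \<union> ?c \<union> ?U1" "closure ?U2 \<subseteq> ?c2 \<union> ?c \<union> ?U2"
    using closed by (simp_all add: closure_inside_subset)
  have I: "?I \<inter> (?c1 \<union> ?c2) = {}" by (rule inside_no_overlap)
  define V1 where "V1 = ?U1 \<union> (?c1 - ?c)"
  define V2 where "V2 = ?U2 \<union> (?c2 - ?c)"
  have pq: "{p, q} \<subseteq> ?c" using int by blast
  show thesis
  proof (rule that)
    show "V1 \<inter> V2 = {}" using split I int pq unfolding V1_def V2_def by blast
    show "?I \<union> ?c1 \<union> ?c2 - ?c \<subseteq> V1 \<union> V2" using split unfolding V1_def V2_def by blast
    show "?c1 - ?c \<subseteq> V1" "?c2 - ?c \<subseteq> V2" by (auto simp: V1_def V2_def)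
    fix K assume K: "connected K" "K \<subseteq> ?I - ?c"
    then have "K \<subseteq> ?U1 \<union> ?U2" using split by blast
    then have "K \<subseteq> ?U1 \<or> K \<subseteq> ?U2"
      using connectedD[OF K(1), of ?U1 ?U2] split closed open_inside by blast
    then have "closure K \<subseteq> closure ?U1 \<or> closure K \<subseteq> closure ?U2" by (meson closure_mono)
    then show "closure K - ?c \<subseteq> V1 \<or> closure K - ?c \<subseteq> V2"
      using cl unfolding V1_def V2_def by blast
  qed
qed

text \<open>The image is connected with more than one point, so each of its points is a limit point,
  and removing two points does not affect limit points.\<close>

lemma ends_in_closure_endless:
  fixes c :: "real \<Rightarrow> 'a::real_normed_vector"
  assumes "simple_path c"
  shows "pathstart c \<in> closure (path_image c - {pathstart c, pathfinish c})" (is "?p \<in> closure ?K")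
    and "pathfinish c \<in> closure (path_image c - {pathstart c, pathfinish c})"
proof -
  have con: "connected (path_image c)" using assms by (rule connected_simple_path_image)
  have ne: "?K \<noteq> {}" using assms by (rule nonempty_simple_path_endless)
  have "path_image c \<noteq> {z}" for z
  proof
    assume "path_image c = {z}"
    then show False using ne pathstart_in_path_image[of c] by simp
  qed
  then have lim: "z islimpt path_image c" if "z \<in> path_image c" for z
    using connected_imp_perfect[OF con that] by blast
  have eq: "insert ?p (insert (pathfinish c) ?K) = path_image c" by auto
  have "z \<in> closure ?K" if "z \<in> path_image c" for z
  proof -
    have "z islimpt insert ?p (insert (pathfinish c) ?K)" unfolding eq by (rule lim[OF that])
    then have "z islimpt ?K" unfolding islimpt_insert .
    then show ?thesis by (simp add: closure_def)
  qed
  then show "?p \<in> closure ?K" "pathfinish c \<in> closure ?K" by auto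
qed

section \<open>Paths of a plane graph as arcs of its drawing\<close>

definition touched :: "('v, 'd) multipole \<Rightarrow> 'd set \<Rightarrow> 'v set" where
  "touched M E = {v. \<exists>d\<in>E. endv M d = Some v \<or> endv M (mate M d) = Some v}"

locale plane_graph =
  fixes M :: "('v, 'd) multipole" and pos :: "'v \<Rightarrow> complex" and \<gamma> :: "'d \<Rightarrow> real \<Rightarrow> complex"
  assumes cubic: "cubic_graph M" and plane: "plane_embedding M pos \<gamma>"
begin

lemma wf: "wf_multipole M" and nosemi: "semiedges M = {}" and inv: "involutive M"
  using cubic by (auto simp: cubic_graph_def cubic_multipole_def intro: wf_imp_involutive)

lemma curve:
  assumes "d \<in> ends M" "endv M d = Some u" "endv M (mate M d) = Some v"
  shows "simple_path (\<gamma> d)" "pathstart (\<gamma> d) = pos u" "pathfinish (\<gamma> d) = pos v"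
    "path_image (\<gamma> d) \<inter> pos ` verts M = {pos u, pos v}"
proof -
  note i = involutiveD[OF inv assms(1)]
  show 1: "simple_path (\<gamma> d)" "pathstart (\<gamma> d) = pos u"
    using plane assms by (auto simp: plane_embedding_def)
  have "pathstart (\<gamma> (mate M d)) = pos (the (endv M (mate M d)))" "\<gamma> (mate M d) = reversepath (\<gamma> d)"
    using plane assms(1) i(1) unfolding plane_embedding_def by blast+
  then show 2: "pathfinish (\<gamma> d) = pos v" by (simp add: assms(3))
  show "path_image (\<gamma> d) \<inter> pos ` verts M = {pos u, pos v}"
    using plane assms(1) unfolding plane_embedding_def 1(2)[symmetric] 2[symmetric] by blast
qed

lemma vert: "d \<in> ends M \<Longrightarrow> \<exists>v. endv M d = Some v \<and> v \<in> verts M"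
  using cubic_graph_endv[OF cubic] by metis

lemma touched_verts: "E \<subseteq> ends M \<Longrightarrow> touched M E \<subseteq> verts M"
proof
  fix v assume "E \<subseteq> ends M" "v \<in> touched M E"
  then obtain d where "d \<in> ends M" "endv M d = Some v \<or> endv M (mate M d) = Some v"
    by (auto simp: touched_def)
  then show "v \<in> verts M" using vert[of d] vert[of "mate M d"] involutiveD(1)[OF inv] by auto
qed

lemma pos_eq_iff: "u \<in> verts M \<Longrightarrow> v \<in> verts M \<Longrightarrow> pos u = pos v \<longleftrightarrow> u = v"
  using plane by (auto simp: plane_embedding_def inj_on_def)

lemma pos_on_curves:
  assumes "E \<subseteq> ends M" "v \<in> verts M"
  shows "pos v \<in> (\<Union>d\<in>E. path_image (\<gamma> d)) \<longleftrightarrow> v \<in> touched M E"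
proof -
  have "pos v \<in> path_image (\<gamma> d) \<longleftrightarrow> endv M d = Some v \<or> endv M (mate M d) = Some v"
    if "d \<in> E" for d
  proof -
    have d: "d \<in> ends M" using that assms by auto
    obtain s t where st: "endv M d = Some s" "s \<in> verts M" "endv M (mate M d) = Some t" "t \<in> verts M"
      using vert[OF d] vert[OF involutiveD(1)[OF inv d]] by auto
    have "pos v \<in> path_image (\<gamma> d) \<longleftrightarrow> pos v \<in> {pos s, pos t}"
      using curve(4)[OF d st(1,3)] assms(2) by blast
    then show ?thesis using st pos_eq_iff assms(2) by auto
  qed
  then show ?thesis by (auto simp: touched_def)
qed

lemma curve_Int:
  assumes "d \<in> ends M" "d' \<in> ends M" "edge M d \<noteq> edge M d'"
  shows "path_image (\<gamma> d) \<inter> path_image (\<gamma> d') \<subseteq> pos ` verts M"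
  using plane assms by (simp add: plane_embedding_def)

text \<open>Curves of different edges meet only in vertex positions, and a curve contains the
  positions of its own endpoints only.\<close>

lemma curves_Int:
  assumes E: "E \<subseteq> ends M" "E' \<subseteq> ends M" and ne: "\<And>d d'. d \<in> E \<Longrightarrow> d' \<in> E' \<Longrightarrow> edge M d \<noteq> edge M d'"
  shows "(\<Union>d\<in>E. path_image (\<gamma> d)) \<inter> (\<Union>d\<in>E'. path_image (\<gamma> d)) =
    pos ` (touched M E \<inter> touched M E')"
proof (intro equalityI subsetI)
  fix z assume z: "z \<in> (\<Union>d\<in>E. path_image (\<gamma> d)) \<inter> (\<Union>d\<in>E'. path_image (\<gamma> d))"
  then obtain d d' where d: "d \<in> E" "d' \<in> E'" "z \<in> path_image (\<gamma> d)" "z \<in> path_image (\<gamma> d')" by auto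
  have "z \<in> pos ` verts M"
    using curve_Int[of d d'] ne[OF d(1,2)] d E by auto
  then obtain v where v: "v \<in> verts M" "z = pos v" by auto
  have "v \<in> touched M E" "v \<in> touched M E'"
    using z pos_on_curves[OF E(1) v(1)] pos_on_curves[OF E(2) v(1)] unfolding v(2) by simp_all
  then show "z \<in> pos ` (touched M E \<inter> touched M E')" using v by simp
next
  fix z assume "z \<in> pos ` (touched M E \<inter> touched M E')"
  then obtain v where v: "v \<in> touched M E" "v \<in> touched M E'" "z = pos v" by auto
  then have "v \<in> verts M" using touched_verts[OF E(1)] by auto
  then show "z \<in> (\<Union>d\<in>E. path_image (\<gamma> d)) \<inter> (\<Union>d\<in>E'. path_image (\<gamma> d))"
    using pos_on_curves[OF E(1), of v] pos_on_curves[OF E(2), of v] v by simp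
qed

lemma spath_touched:
  assumes "spath M x ds y"
  shows "Some ` touched M (set ds) \<subseteq> set (x # map (\<lambda>d. endv M (mate M d)) ds)"
proof
  fix z assume "z \<in> Some ` touched M (set ds)"
  then obtain d where "d \<in> set ds" "endv M d = z \<or> endv M (mate M d) = z"
    by (auto simp: touched_def)
  then show "z \<in> set (x # map (\<lambda>d. endv M (mate M d)) ds)"
    using spath_ends_on_path[OF assms] by metis
qed

text \<open>The curves are joined one by one: the first meets the rest of the path only in
  \<open>pos t\<close>, because \<open>u\<close> does not occur again. For the same reason it is no
  loop and hence an arc.\<close>

lemma spath_arc:
  assumes "spath M (Some u) ds (Some v)" "ds \<noteq> []"
  shows "\<exists>q. arc q \<and> pathstart q = pos u \<and> pathfinish q = pos v \<and>
    path_image q = (\<Union>d\<in>set ds. path_image (\<gamma> d))"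
  using assms
proof (induction ds arbitrary: u)
  case (Cons d ds)
  have d: "d \<in> ends M" "endv M d = Some u" using Cons.prems by (auto simp: spath_Cons)
  then have u: "u \<in> verts M" using vert by force
  obtain t where t: "endv M (mate M d) = Some t" "t \<in> verts M"
    using vert[OF involutiveD(1)[OF inv d(1)]] by blast
  note cd = curve[OF d t(1)]
  have ds: "spath M (Some t) ds (Some v)" and n: "Some u \<notin> set (Some t # map (\<lambda>d. endv M (mate M d)) ds)"
    using Cons.prems t by (auto simp: spath_Cons)
  have "u \<noteq> t" using n by auto
  then have arc: "arc (\<gamma> d)"
    using cd pos_eq_iff[OF u t(2)] by (simp add: arc_simple_path)
  show ?case
  proof (cases "ds = []")
    case True
    then show ?thesis using arc cd ds by auto
  next
    case False
    from Cons.IH[OF ds this] obtain q where q: "arc q" "pathstart q = pos t" "pathfinish q = pos v"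
      "path_image q = (\<Union>d\<in>set ds. path_image (\<gamma> d))" by blast
    have "set ds \<subseteq> ends M" using ds by (simp add: spath_def)
    moreover have "edge M d \<noteq> edge M d'" if "d' \<in> set ds" for d'
      by (rule spath_edges[OF inv Cons.prems(1) d that])
    ultimately have "path_image (\<gamma> d) \<inter> path_image q = pos ` (touched M {d} \<inter> touched M (set ds))"
      using curves_Int[of "{d}" "set ds"] d q(4) by simp
    also have "touched M {d} = {u, t}" using d t by (auto simp: touched_def)
    also have "pos ` ({u, t} \<inter> touched M (set ds)) \<subseteq> {pos t}"
      using n spath_touched[OF ds] by blast
    finally have "arc (\<gamma> d +++ q)"
      using arc q cd by (intro arc_join) auto
    moreover have "path_image (\<gamma> d +++ q) = (\<Union>d\<in>set (d # ds). path_image (\<gamma> d))"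
      using q cd by (simp add: path_image_join)
    ultimately show ?thesis using q cd by (intro exI[of _ "\<gamma> d +++ q"]) auto
  qed
qed simp

end

lemma inner_vertex_of_long_spath:
  assumes "spath M x ds y" "length ds \<noteq> 1" "ds \<noteq> []"
  obtains d where "d \<in> set ds" "endv M d \<noteq> x" "endv M d \<noteq> y"
proof -
  obtain d e rest where ds: "ds = d # e # rest"
    using assms(2,3) by (cases ds; cases "tl ds") auto
  have w: "walk M x ds y" using assms(1) by (simp add: spath_def)
  have dist: "distinct (map (endv M) ds @ [y])" using assms(1) by (rule spath_initials)
  show thesis
    by (rule that[of e]) (use w dist in \<open>auto simp: ds\<close>)
qed

context plane_graph
begin

text \<open>
  The path \<open>x, w, y\<close> is a chord of the outer circuit. The rest of the tree is connected, so it
  lies on one side of the chord, and the arc of the circuit on the other side has no inner vertex.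
\<close>

lemma chord_cuts_off_edge:
  fixes L1 L2 :: "'d list" and T :: "'d set"
  assumes L: "spath M (Some x) L1 (Some y)" "spath M (Some y) L2 (Some x)" "L1 \<noteq> []" "L2 \<noteq> []"
    and Lv: "touched M (set L1) \<inter> touched M (set L2) = {x, y}"
    and Le: "\<And>d d'. d \<in> set L1 \<Longrightarrow> d' \<in> set L2 \<Longrightarrow> edge M d \<noteq> edge M d'"
    and outer: "frontier (outside (drawing M pos \<gamma>)) = (\<Union>d\<in>set L1 \<union> set L2. path_image (\<gamma> d))"
    and T: "T \<subseteq> ends M" "\<And>d. d \<in> T \<Longrightarrow> mate M d \<in> T"
    and TL: "\<And>d d'. d \<in> T \<Longrightarrow> d' \<in> set L1 \<union> set L2 \<Longrightarrow> edge M d \<noteq> edge M d'"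
    and conn: "\<And>A v. x \<in> A \<Longrightarrow>
        (\<And>d s t. d \<in> T \<Longrightarrow> endv M d = Some s \<Longrightarrow> endv M (mate M d) = Some t \<Longrightarrow> s \<in> A \<Longrightarrow> t \<in> A) \<Longrightarrow>
        v \<in> verts M \<Longrightarrow> v \<in> A"
    and w: "w \<notin> touched M (set L1)" "w \<notin> touched M (set L2)"
    and ab: "a \<in> T" "b \<in> T" "endv M a = Some w" "endv M b = Some w"
      "endv M (mate M a) = Some x" "endv M (mate M b) = Some y"
    and at_x: "\<And>d. d \<in> T \<Longrightarrow> endv M d = Some x \<Longrightarrow> d = mate M a"
    and at_y: "\<And>d. d \<in> T \<Longrightarrow> endv M d = Some y \<Longrightarrow> d = mate M b"
    and e: "e \<in> T" "e \<noteq> a" "e \<noteq> b" "endv M e = Some w"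
    and at_w: "\<And>d. d \<in> T \<Longrightarrow> endv M d = Some w \<Longrightarrow> d \<in> {a, b, e}"
  shows "length L1 = 1 \<or> length L2 = 1"
proof -
  let ?curves = "\<lambda>E. \<Union>d\<in>E. path_image (\<gamma> d)"
  have abM: "a \<in> ends M" "b \<in> ends M" "e \<in> ends M" using ab e T by auto
  note ma = involutiveD[OF inv abM(1)] and mb = involutiveD[OF inv abM(2)] and me = involutiveD[OF inv abM(3)]
  have xy: "x \<in> touched M (set L1)" "y \<in> touched M (set L1)" "x \<in> touched M (set L2)" "y \<in> touched M (set L2)"
    using Lv by auto
  then have ne: "x \<noteq> w" "y \<noteq> w" using w by auto
  have LM: "set L1 \<subseteq> ends M" "set L2 \<subseteq> ends M" using L by (auto simp: spath_def)
  have "x \<noteq> y" using spath_initials[OF L(1)] L(1,3) by (cases L1) (auto simp: spath_Cons)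
  let ?E = "{mate M a, b}"
  have tc: "touched M ?E = {x, w, y}" using ab ma by (auto simp: touched_def)
  have EM: "?E \<subseteq> ends M" using ma abM by simp
  have vM: "x \<in> verts M" "w \<in> verts M" "y \<in> verts M" using touched_verts[OF EM] tc by auto
  have "spath M (Some x) [mate M a, b] (Some y)"
    using ab ma mb abM ne \<open>x \<noteq> y\<close> by (simp add: spath_Cons)
  from spath_arc[OF this] obtain c where c: "arc c" "pathstart c = pos x" "pathfinish c = pos y"
    "path_image c = ?curves ?E" by auto
  from spath_arc[OF L(1,3)] obtain c1 where c1: "arc c1" "pathstart c1 = pos x" "pathfinish c1 = pos y"
    "path_image c1 = ?curves (set L1)" by auto
  from spath_arc[OF L(2,4)] obtain c2 where c2: "arc c2" "pathstart c2 = pos y" "pathfinish c2 = pos x"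
    "path_image c2 = ?curves (set L2)" by auto
  have EL: "edge M d \<noteq> edge M d'" if "d \<in> set L1 \<union> set L2" "d' \<in> ?E" for d d'
    using TL[of d' d] that ab T(2)[OF ab(1)] by auto
  have i12: "path_image c1 \<inter> path_image c2 = {pos x, pos y}"
    unfolding c1(4) c2(4) using curves_Int[OF LM Le] Lv by simp
  have "touched M (set L1) \<inter> {x, w, y} = {x, y}" "touched M (set L2) \<inter> {x, w, y} = {x, y}"
    using w xy by auto
  then have i1: "path_image c1 \<inter> path_image c = {pos x, pos y}"
    and i2: "path_image c2 \<inter> path_image c = {pos x, pos y}"
    unfolding c1(4) c2(4) c(4)
    using curves_Int[OF LM(1) EM EL] curves_Int[OF LM(2) EM EL] tc by simp_all
  let ?G = "path_image c1 \<union> path_image c2"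
  have J: "simple_path (c1 +++ c2)" "pathfinish (c1 +++ c2) = pathstart (c1 +++ c2)"
    "path_image (c1 +++ c2) = ?G"
    using c1 c2 i12 by (auto intro!: simple_path_join_loop simp: path_image_join)
  have fin: "finite (verts M)" "finite (ends M)" using wf by (auto simp: wf_multipole_def)
  have "compact (path_image (\<gamma> d))" if "d \<in> ends M" for d
    using plane that by (auto simp: plane_embedding_def compact_simple_path_image)
  then have "compact (drawing M pos \<gamma>)"
    unfolding drawing_def using fin by (intro compact_Un compact_UN) (auto intro: finite_imp_compact)
  from frontier_outside_eq_curve[OF J(1,2) this]
  have "drawing M pos \<gamma> \<inter> outside ?G = {}"
    unfolding J(3) outer by (simp add: c1(4) c2(4) Un_commute)
  then have dr: "drawing M pos \<gamma> \<subseteq> inside ?G \<union> ?G" using inside_Un_outside[of ?G] by blast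
  have dv: "pos v \<in> drawing M pos \<gamma>" if "v \<in> verts M" for v using that by (simp add: drawing_def)
  have de: "path_image (\<gamma> d) \<subseteq> drawing M pos \<gamma>" if "d \<in> ends M" for d
    using that by (auto simp: drawing_def)
  have on_c: "pos v \<in> path_image c \<longleftrightarrow> v \<in> {x, w, y}" if "v \<in> verts M" for v
    unfolding c(4) using pos_on_curves[OF EM that] tc by simp
  have "pos w \<notin> ?G"
    unfolding c1(4) c2(4) using pos_on_curves[OF LM(1) vM(2)] pos_on_curves[OF LM(2) vM(2)] w by simp
  \<comment> \<open>\<open>w\<close> is off the circuit, hence strictly inside it; so the chord
    meets the inside, as \<open>theta_sides\<close> requires.\<close>
  then have "pos w \<in> path_image c \<inter> inside ?G" using dr dv[OF vM(2)] on_c[OF vM(2)] by auto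
  then have nonempty: "path_image c \<inter> inside ?G \<noteq> {}" by auto
  obtain V1 V2 where V: "V1 \<inter> V2 = {}" "inside ?G \<union> path_image c1 \<union> path_image c2 - path_image c \<subseteq> V1 \<union> V2"
    "path_image c1 - path_image c \<subseteq> V1" "path_image c2 - path_image c \<subseteq> V2"
    "\<And>K. connected K \<Longrightarrow> K \<subseteq> inside ?G - path_image c \<Longrightarrow>
       closure K - path_image c \<subseteq> V1 \<or> closure K - path_image c \<subseteq> V2"
    by (rule theta_sides[of c1 "reversepath c2" c "pos x" "pos y"])
      (use c c1 c2 i12 i1 i2 nonempty in \<open>simp_all add: arc_reversepath\<close>)
  \<comment> \<open>The edge without its endpoints avoids the circuit and the chord, so it lies
    inside on one side; its endpoints are in its closure and off the chord.\<close>
  have side: "\<exists>V\<in>{V1, V2}. pos s \<in> V \<and> pos t \<in> V"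
    if d: "d \<in> T" "endv M d = Some s" "endv M (mate M d) = Some t" and st: "s \<notin> {x, w, y}" "t \<notin> {x, w, y}" for d s t
  proof -
    have dM: "d \<in> ends M" using d T by auto
    note cd = curve[OF dM d(2,3)]
    have stM: "s \<in> verts M" "t \<in> verts M" using vert[OF dM] vert[OF involutiveD(1)[OF inv dM]] d by auto
    let ?K = "path_image (\<gamma> d) - {pos s, pos t}"
    have td: "touched M {d} = {s, t}" using d by (auto simp: touched_def)
    have LM': "set L1 \<union> set L2 \<subseteq> ends M" "{d} \<subseteq> ends M" using LM dM by auto
    have "path_image (\<gamma> d) \<inter> ?G = pos ` ({s, t} \<inter> touched M (set L1 \<union> set L2))"
      using curves_Int[OF LM'(2,1)] TL d(1) td by (simp add: c1(4) c2(4) Un_commute)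
    then have 1: "?K \<inter> ?G = {}" by auto
    have "edge M d \<noteq> edge M d'" if "d' \<in> ?E" for d'
    proof
      assume "edge M d = edge M d'"
      then have "d = d' \<or> d = mate M d'" by (rule edge_eqD)
      then show False using that d st ab ma by auto
    qed
    then have "path_image (\<gamma> d) \<inter> path_image c = pos ` ({s, t} \<inter> {x, w, y})"
      using curves_Int[OF LM'(2) EM] td tc by (simp add: c(4))
    then have 2: "?K \<inter> path_image c = {}" using st by auto
    have "connected ?K" using connected_simple_path_endless[OF cd(1)] cd(2,3) by simp
    moreover have "?K \<subseteq> inside ?G - path_image c" using 1 2 de[OF dM] dr by auto
    ultimately have "closure ?K - path_image c \<subseteq> V1 \<or> closure ?K - path_image c \<subseteq> V2" by (rule V(5))
    moreover have "pos s \<in> closure ?K - path_image c" "pos t \<in> closure ?K - path_image c"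
      using ends_in_closure_endless[OF cd(1)] cd(2,3) on_c stM st by simp_all
    ultimately show ?thesis by blast
  qed
  obtain z where z: "endv M (mate M e) = Some z" "z \<in> verts M" using vert[OF me(1)] by blast
  have "z \<noteq> x" "z \<noteq> y"
    using at_x[of "mate M e"] at_y[of "mate M e"] T(2)[OF e(1)] z e me ma mb by metis+
  \<comment> \<open>The third edge at \<open>w\<close> is the only way from the chord into the rest
    of the tree, so the side of its other end \<open>z\<close> decides. If it were a loop, either
    side would serve.\<close>
  have "\<exists>V\<in>{V1, V2}. z = w \<or> pos z \<in> V"
  proof (cases "z = w")
    case False
    then have "pos z \<in> V1 \<union> V2"
      using dr dv[OF z(2)] on_c[OF z(2)] \<open>z \<noteq> x\<close> \<open>z \<noteq> y\<close> V(2) by blast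
    then show ?thesis by blast
  qed auto
  then obtain V where VV: "V \<in> {V1, V2}" "z = w \<or> pos z \<in> V" by blast
  \<comment> \<open>The chord with everything on the side of \<open>z\<close>. It is closed under
    the edges in \<open>T\<close>: \<open>x\<close> and \<open>y\<close> lead only to
    \<open>w\<close>, \<open>w\<close> only to \<open>x\<close>, \<open>y\<close> and
    \<open>z\<close>, and the edges off the chord stay on one side.\<close>
  define A where "A = {x, w, y} \<union> {v \<in> verts M. pos v \<in> V}"
  have step: "t \<in> A" if d: "d \<in> T" "endv M d = Some s" "endv M (mate M d) = Some t" and s: "s \<in> A" for d s t
  proof -
    have dM: "d \<in> ends M" using d T by auto
    have tM: "t \<in> verts M" using vert[OF involutiveD(1)[OF inv dM]] d by auto
    consider "t \<in> {x, w, y}" | "s = x" | "s = y" | "s = w" | "s \<notin> {x, w, y}" "t \<notin> {x, w, y}" by blast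
    then show ?thesis
    proof cases
      case 2 then show ?thesis using at_x[OF d(1)] d ma ab by (auto simp: A_def)
    next
      case 3 then show ?thesis using at_y[OF d(1)] d mb ab by (auto simp: A_def)
    next
      case 4 then show ?thesis using at_w[OF d(1)] d ab z VV by (auto simp: A_def)
    next
      case 5
      then have "pos s \<in> V" using s by (auto simp: A_def)
      then have "pos t \<in> V" using side[OF d 5] VV(1) V(1) by blast
      then show ?thesis using tM by (simp add: A_def)
    qed (auto simp: A_def)
  qed
  have all: "v \<in> {x, w, y} \<or> pos v \<in> V" if "v \<in> verts M" for v
    using conn[of A v] step that unfolding A_def by blast
  \<comment> \<open>An arc with more than one edge has a further vertex, which is off the chord and
    would have to be in \<open>V\<close>.\<close>
  have short: "length L = 1"
    if L': "L = L1 \<or> L = L2" and disj: "V \<inter> (?curves (set L) - path_image c) = {}" for L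
  proof (rule ccontr)
    assume n: "length L \<noteq> 1"
    have sp: "\<exists>p q. spath M p L q \<and> {p, q} = {Some x, Some y}" and "L \<noteq> []" and LM'': "set L \<subseteq> ends M"
      and wL: "w \<notin> touched M (set L)"
      using L' L LM w by auto
    then obtain p q where pq: "spath M p L q" "{p, q} = {Some x, Some y}" by blast
    obtain d where d: "d \<in> set L" "endv M d \<noteq> p" "endv M d \<noteq> q"
      using inner_vertex_of_long_spath[OF pq(1) n \<open>L \<noteq> []\<close>] by blast
    obtain v where v: "endv M d = Some v" "v \<in> verts M" using vert d LM'' by blast
    have "v \<in> touched M (set L)" using d v by (auto simp: touched_def)
    moreover have "v \<notin> {x, w, y}" using d v pq wL calculation by auto
    ultimately show False
      using all[OF v(2)] on_c[OF v(2)] pos_on_curves[OF LM'' v(2)] disj by blast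
  qed
  show ?thesis
  proof (cases "V = V1")
    case True
    then show ?thesis using short[of L2] V(1,4) c2(4) by blast
  next
    case False
    then show ?thesis using short[of L1] V(1,3) VV(1) c1(4) by blast
  qed
qed

end

section \<open>Leaves with a common neighbour are consecutive on the circuit\<close>

lemma walkI:
  assumes "\<And>i. i < length C \<Longrightarrow>
      endv M (mate M (C ! i)) = (if Suc i < length C then endv M (C ! Suc i) else y)" "C \<noteq> []"
  shows "walk M (endv M (hd C)) C y"
  using assms
proof (induction C)
  case (Cons d C)
  show ?case
  proof (cases "C = []")
    case False
    have "walk M (endv M (hd C)) C y"
      by (rule Cons.IH[OF _ False]) (use Cons.prems(1)[of "Suc i" for i] in auto)
    moreover have "endv M (mate M d) = endv M (hd C)"
      using Cons.prems(1)[of 0] False by (simp add: hd_conv_nth)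
    ultimately show ?thesis by simp
  qed (use Cons.prems(1)[of 0] in simp)
qed simp

lemma circuit_imp_walk:
  assumes "circuit M C"
  shows "walk M (endv M (hd C)) C (endv M (hd C))"
proof (rule walkI)
  show "C \<noteq> []" using assms by (simp add: circuit_def)
  fix i assume i: "i < length C"
  then have "endv M (mate M (C ! i)) = endv M (C ! (Suc i mod length C))"
    using assms by (simp add: circuit_def)
  moreover have "Suc i mod length C = (if Suc i < length C then Suc i else 0)"
    using i by (simp add: mod_Suc)
  ultimately show "endv M (mate M (C ! i)) = (if Suc i < length C then endv M (C ! Suc i) else endv M (hd C))"
    using \<open>C \<noteq> []\<close> by (simp add: hd_conv_nth)
qed

text \<open>Cutting the closed walk at the starts of \<open>B\<close> and \<open>E\<close> leaves
  two simple paths, the second of which wraps around through the base point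
  \<open>p\<close>.\<close>

lemma closed_walk_split:
  assumes w: "walk M p (A @ B @ E) p" and dist: "distinct (map (endv M) (A @ B @ E))"
    and sub: "set (A @ B @ E) \<subseteq> ends M" and ne: "B \<noteq> []" "E \<noteq> []"
  shows "spath M (endv M (hd B)) B (endv M (hd E))" "spath M (endv M (hd E)) (E @ A) (endv M (hd B))"
proof -
  obtain q r where q: "walk M p A q" "walk M q B r" "walk M r E p"
    using w by (auto simp: walk_append)
  have qr: "q = endv M (hd B)" "r = endv M (hd E)" using q ne by (auto simp: neq_Nil_conv)
  have w2: "walk M r (E @ A) q" using q by (auto simp: walk_append)
  have "hd B \<in> set B" "hd E \<in> set E" using ne by auto
  then have "distinct (map (endv M) B @ [r])" "distinct (map (endv M) (E @ A) @ [q])"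
    using dist unfolding qr by auto
  then have "spath M q B r" "spath M r (E @ A) q"
    using sub q(2) w2 unfolding spath_def walk_verts[OF q(2)] walk_verts[OF w2] by auto
  then show "spath M (endv M (hd B)) B (endv M (hd E))" "spath M (endv M (hd E)) (E @ A) (endv M (hd B))"
    unfolding qr by auto
qed

lemma touched_spath:
  assumes "spath M x ds y" "ds \<noteq> []" "v \<in> touched M (set ds)"
  shows "Some v \<in> endv M ` set ds \<union> {y}"
proof -
  have w: "walk M x ds y" using assms by (simp add: spath_def)
  obtain d where d: "d \<in> set ds" "endv M d = Some v \<or> endv M (mate M d) = Some v"
    using assms(3) unfolding touched_def by blast
  have "Some v \<in> set (map (endv M) ds @ [y])"
    using spath_ends_on_path[OF assms(1) d(1)] d(2) unfolding walk_verts[OF w] by metis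
  then show ?thesis by auto
qed

lemma spath_ends_touched:
  assumes "spath M (Some u) ds (Some v)" "ds \<noteq> []"
  shows "u \<in> touched M (set ds)" "v \<in> touched M (set ds)"
proof -
  have w: "walk M (Some u) ds (Some v)" using assms by (simp add: spath_def)
  have "endv M (hd ds) = Some u" using w assms(2) by (cases ds) auto
  moreover have "endv M (mate M (last ds)) = Some v"
    using arg_cong[OF walk_verts[OF w], of last] assms(2) by (simp add: last_map)
  ultimately show "u \<in> touched M (set ds)" "v \<in> touched M (set ds)"
    using hd_in_set[OF assms(2)] last_in_set[OF assms(2)] unfolding touched_def by blast+
qed

lemma halin_tree_simps [simp]:
  "verts (halin_tree H C) = verts H" "mate (halin_tree H C) = mate H"
  "endv (halin_tree H C) = endv H" "ends (halin_tree H C) = ends H - \<Union> (edge H ` set C)"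
  by (simp_all add: halin_tree_def delete_edges_def)

lemma wf_halin_tree:
  assumes "wf_multipole H" "set C \<subseteq> ends H"
  shows "wf_multipole (halin_tree H C)"
proof -
  have inv: "involutive H" using assms(1) by (rule wf_imp_involutive)
  have closed: "mate H d \<in> ends (halin_tree H C)" if d: "d \<in> ends (halin_tree H C)" for d
  proof -
    have "d \<in> ends H" using d by simp
    note i = involutiveD[OF inv this]
    have "mate H d \<noteq> c \<and> mate H d \<noteq> mate H c" if "c \<in> set C" for c
    proof -
      have "d \<noteq> mate H c" "d \<noteq> c" using d that by (auto simp: edge_def)
      then show ?thesis
        using i(3) involutive_mate_eq_iff[OF inv \<open>d \<in> ends H\<close>, of c] that assms(2) by auto
    qed
    then show ?thesis using i(1) by (auto simp: edge_def)
  qed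
  have sub: "d \<in> ends H" if "d \<in> ends (halin_tree H C)" for d using that by simp
  show ?thesis
    unfolding wf_multipole_def
  proof (intro conjI ballI)
    fix d assume d: "d \<in> ends (halin_tree H C)"
    note involutiveD[OF inv sub[OF d]]
    then show "mate (halin_tree H C) d \<in> ends (halin_tree H C)" "mate (halin_tree H C) d \<noteq> d"
      "mate (halin_tree H C) (mate (halin_tree H C) d) = d"
      using closed[OF d] by (simp_all only: halin_tree_simps not_False_eq_True)
    show "\<forall>v. endv (halin_tree H C) d = Some v \<longrightarrow> v \<in> verts (halin_tree H C)"
      using assms(1) sub[OF d] by (simp add: wf_multipole_def)
  qed (use assms(1) in \<open>simp_all add: wf_multipole_def\<close>)
qed

lemma degree_1_unique:
  assumes "degree M v = 1" "d \<in> ends_at M v" "e \<in> ends_at M v"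
  shows "d = e"
  using assms unfolding degree_def by (metis card_1_singletonE singletonD)

lemma connected_closed_set:
  assumes "connected_graph M" "x \<in> verts M" "v \<in> verts M" "x \<in> A"
    and "\<And>d s t. d \<in> ends M \<Longrightarrow> endv M d = Some s \<Longrightarrow> endv M (mate M d) = Some t \<Longrightarrow> s \<in> A \<Longrightarrow> t \<in> A"
  shows "v \<in> A"
proof -
  have "(x, v) \<in> (adj M)\<^sup>*" using assms by (simp add: connected_graph_def)
  then show ?thesis
    by (induction rule: rtrancl_induct) (use assms(4,5) in \<open>auto simp: adj_def\<close>)
qed

lemma cvert_Some:
  assumes "circuit H C" "i < length C"
  shows "endv H (C ! i) = Some (cvert H C i)"
  using assms by (auto simp: circuit_def cvert_def)

text \<open>The circuit is cut at the positions \<open>i\<close> and \<open>j\<close> into two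
  paths. All its vertices are leaves of the tree, so \<open>w\<close>, of degree 3, is off the
  circuit, and the two leaves have no tree edges besides those of \<open>a\<close> and
  \<open>b\<close>. This is the situation of \<open>chord_cuts_off_edge\<close>.\<close>

lemma (in plane_graph) cherry_consecutive_aux:
  fixes C :: "'d list"
  defines "S \<equiv> halin_tree M C"
  assumes C: "circuit M C" and conn: "connected_graph S"
    and outer: "bounds_outer_face M pos \<gamma> C"
    and leaves: "cvert M C ` {..<length C} = {v \<in> verts S. degree S v = 1}"
    and w: "degree S w = 3" "a \<in> ends_at S w" "b \<in> ends_at S w" "a \<noteq> b"
    and xy: "endv M (mate M a) = Some (cvert M C i)" "endv M (mate M b) = Some (cvert M C j)"
    and ij: "i < j" "j < length C"
  shows "j = Suc i \<or> (i = 0 \<and> j = length C - 1)"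
proof -
  let ?x = "cvert M C i" and ?y = "cvert M C j"
  let ?A = "take i C" and ?B = "take (j - i) (drop i C)" and ?E = "drop j C"
  have split: "C = ?A @ ?B @ ?E" using ij
    by (metis append_take_drop_id drop_drop le_add_diff_inverse2 less_imp_le)
  have sub: "set C \<subseteq> ends M" and dv: "distinct (map (endv M) C)" and de: "distinct (map (edge M) C)"
    using C by (auto simp: circuit_def)
  have ne: "?B \<noteq> []" "?E @ ?A \<noteq> []" "?E \<noteq> []" using ij by auto
  have hd: "hd ?B = C ! i" "hd ?E = C ! j" using ij by (simp_all add: hd_drop_conv_nth hd_take)
  have hds: "endv M (hd ?B) = Some ?x" "endv M (hd ?E) = Some ?y"
    unfolding hd using cvert_Some[OF C] ij by simp_all
  have L: "spath M (Some ?x) ?B (Some ?y)" "spath M (Some ?y) (?E @ ?A) (Some ?x)"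
    using closed_walk_split[of M _ ?A ?B ?E, folded split, OF circuit_imp_walk[OF C] dv sub ne(1,3)]
    unfolding hds by auto
  have setC: "set ?B \<union> set (?E @ ?A) = set C" by (subst (4) split) auto
  have disj_v: "endv M ` set ?B \<inter> endv M ` set (?E @ ?A) = {}"
    using dv by (subst (asm) split) auto
  have disj_e: "edge M d \<noteq> edge M d'" if "d \<in> set ?B" "d' \<in> set (?E @ ?A)" for d d'
    using de that by (subst (asm) split) auto
  have Lv: "touched M (set ?B) \<inter> touched M (set (?E @ ?A)) = {?x, ?y}"
  proof
    show "touched M (set ?B) \<inter> touched M (set (?E @ ?A)) \<subseteq> {?x, ?y}"
      using touched_spath[OF L(1) ne(1)] touched_spath[OF L(2) ne(2)] disj_v by blast
    show "{?x, ?y} \<subseteq> touched M (set ?B) \<inter> touched M (set (?E @ ?A))"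
      using spath_ends_touched[OF L(1) ne(1)] spath_ends_touched[OF L(2) ne(2)] by simp
  qed
  have wfS: "wf_multipole S" unfolding S_def by (rule wf_halin_tree[OF wf sub])
  note iS = involutiveD[OF wf_imp_involutive[OF wfS]]
  have S: "verts S = verts M" "mate S = mate M" "endv S = endv M" "ends S \<subseteq> ends M" by (auto simp: S_def)
  have at: "d \<in> ends_at S v \<longleftrightarrow> d \<in> ends S \<and> endv M d = Some v" for d v by (simp add: ends_at_def S)
  have TL: "edge M d \<noteq> edge M d'" if "d \<in> ends S" "d' \<in> set C" for d d'
    using that by (auto simp: S_def edge_def)
  have leaf: "degree S (cvert M C m) = 1 \<and> cvert M C m \<in> verts M" if "m < length C" for m
    using leaves that by (auto simp: S(1))
  have onC: "degree S v = 1" if "d \<in> set C" "endv M d = Some v" for d v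
  proof -
    obtain m where "m < length C" "C ! m = d" using \<open>d \<in> set C\<close> by (auto simp: in_set_conv_nth)
    then show ?thesis using leaf[of m] cvert_Some[OF C, of m] that by auto
  qed
  have not_w: "w \<notin> touched M (set ?B)" "w \<notin> touched M (set (?E @ ?A))"
  proof -
    have "Some w \<notin> endv M ` set C" using onC w(1) by fastforce
    moreover have "w \<noteq> ?x" "w \<noteq> ?y" using leaf[of i] leaf[of j] ij w(1) by auto
    ultimately show "w \<notin> touched M (set ?B)" "w \<notin> touched M (set (?E @ ?A))"
      using touched_spath[OF L(1) ne(1), of w] touched_spath[OF L(2) ne(2), of w] setC by blast+
  qed
  obtain e where e: "e \<in> ends_at S w" "e \<noteq> a" "e \<noteq> b" by (rule degree_3_third[OF w(1)])
  have three: "ends_at S w = {a, b, e}"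
  proof (rule sym, rule card_subset_eq)
    show "finite (ends_at S w)" using w(1) by (metis card.infinite degree_def zero_neq_numeral)
  qed (use w e in \<open>auto simp: degree_def\<close>)
  have ma: "mate M a \<in> ends_at S ?x" "mate M b \<in> ends_at S ?y"
    using w xy iS[of a] iS[of b] by (auto simp: at S)
  have "length ?B = 1 \<or> length (?E @ ?A) = 1"
  proof (rule chord_cuts_off_edge[OF L ne(1,2) Lv disj_e, where T = "ends S" and w = w and a = a and b = b and e = e])
    show "frontier (outside (drawing M pos \<gamma>)) = (\<Union>d\<in>set ?B \<union> set (?E @ ?A). path_image (\<gamma> d))"
      using outer unfolding setC by (simp add: bounds_outer_face_def)
    show "\<And>d d'. d \<in> ends S \<Longrightarrow> d' \<in> set ?B \<union> set (?E @ ?A) \<Longrightarrow> edge M d \<noteq> edge M d'"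
      unfolding setC by (rule TL)
    show "v \<in> A" if "?x \<in> A" "v \<in> verts M"
      "\<And>d s t. d \<in> ends S \<Longrightarrow> endv M d = Some s \<Longrightarrow> endv M (mate M d) = Some t \<Longrightarrow> s \<in> A \<Longrightarrow> t \<in> A" for A v
      using connected_closed_set[OF conn, of ?x v A] that leaf[of i] ij by (simp add: S)
    show "\<And>d. d \<in> ends S \<Longrightarrow> endv M d = Some ?x \<Longrightarrow> d = mate M a"
      using degree_1_unique[of S ?x] leaf[of i] ij ma at by simp
    show "\<And>d. d \<in> ends S \<Longrightarrow> endv M d = Some ?y \<Longrightarrow> d = mate M b"
      using degree_1_unique[of S ?y] leaf[of j] ij ma at by simp
    show "\<And>d. d \<in> ends S \<Longrightarrow> endv M d = Some w \<Longrightarrow> d \<in> {a, b, e}"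
      unfolding three[symmetric] by (simp add: at)
  qed (use S iS w e xy not_w in \<open>auto simp: at\<close>)
  \<comment> \<open>The second path has length \<open>length C - j + i\<close>, which is 1 only if
    \<open>i = 0\<close> and \<open>j = length C - 1\<close>.\<close>
  then show ?thesis using ij by auto
qed

text \<open>The leaves come without an order, and either order fits: the positions 0 and
  \<open>length C - 1\<close> are consecutive too when read modulo \<open>length C\<close>.\<close>

lemma halin_consecutive_cherry:
  fixes H :: "('v, 'd) multipole"
  assumes H: "cubic_halin_graph H C"
  obtains w i where "w \<in> verts H" "degree (halin_tree H C) w = 3" "i < length C"
    "cvert H C i \<noteq> cvert H C (Suc i mod length C)"
    "(cvert H C i, w) \<in> adj (halin_tree H C)" "(cvert H C (Suc i mod length C), w) \<in> adj (halin_tree H C)"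
proof -
  let ?S = "halin_tree H C" and ?k = "length C"
  have cub: "cubic_graph H" and C: "circuit H C" and tr: "tree ?S"
    and deg: "\<forall>v\<in>verts ?S. degree ?S v \<in> {1, 3}" "\<exists>v\<in>verts ?S. degree ?S v = 3"
    and leaves: "cvert H C ` {..<?k} = {v \<in> verts ?S. degree ?S v = 1}"
    using H by (auto simp: cubic_halin_graph_def Let_def)
  obtain pos \<gamma> where emb: "plane_embedding H pos \<gamma>" "bounds_outer_face H pos \<gamma> C"
    using H by (auto simp: cubic_halin_graph_def)
  interpret plane_graph H pos \<gamma> by unfold_locales (fact cub emb)+
  have wfS: "wf_multipole ?S" using wf_halin_tree[OF wf] C by (simp add: circuit_def)
  have semi: "semiedges ?S = {}" using nosemi by (auto simp: semiedges_def)
  have conn: "connected_graph ?S" and acyc: "\<nexists>C'. circuit ?S C'" using tr by (auto simp: tree_def)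
  obtain w x y a b where w: "w \<in> verts ?S" "degree ?S w = 3" "a \<in> ends_at ?S w" "b \<in> ends_at ?S w"
    "a \<noteq> b" "endv ?S (mate ?S a) = Some x" "endv ?S (mate ?S b) = Some y"
    "x \<in> verts ?S" "y \<in> verts ?S" "degree ?S x = 1" "degree ?S y = 1" "x \<noteq> y"
    by (rule tree_cherry[OF wfS semi acyc deg])
  have adj: "(v, w) \<in> adj ?S" if "d \<in> ends_at ?S w" "endv ?S (mate ?S d) = Some v" for d v
  proof -
    have d: "d \<in> ends ?S" "endv ?S d = Some w" using that(1) unfolding ends_at_def by blast+
    note involutiveD[OF wf_imp_involutive[OF wfS] d(1)]
    then show ?thesis using d that(2) unfolding adj_def by (simp only: mem_Collect_eq prod.case) metis
  qed
  note adj = adj[OF w(3,6)] adj[OF w(4,7)]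
  obtain i j where i: "i < ?k" "x = cvert H C i" and j: "j < ?k" "y = cvert H C j"
  proof -
    have "x \<in> cvert H C ` {..<?k}" "y \<in> cvert H C ` {..<?k}" unfolding leaves using w by simp_all
    then show thesis using that by blast
  qed
  have ij: "i \<noteq> j" using w i j by auto
  have "(j = Suc i mod ?k) \<or> (i = Suc j mod ?k)"
  proof (cases "i < j")
    case True
    then have "j = Suc i \<or> (i = 0 \<and> j = ?k - 1)"
      using cherry_consecutive_aux[OF C conn emb(2) leaves w(2-5)] w(6,7) i j by simp
    then show ?thesis using i j by auto
  next
    case False
    then have "i = Suc j \<or> (j = 0 \<and> i = ?k - 1)"
      using cherry_consecutive_aux[OF C conn emb(2) leaves w(2,4,3) w(5)[symmetric]] w(6,7) i j ij by simp
    then show ?thesis using i j by auto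
  qed
  then show thesis
  proof
    assume "j = Suc i mod ?k"
    then show thesis using that[of w i] w(1,2,12) adj i j by simp
  next
    assume "i = Suc j mod ?k"
    then show thesis using that[of w j] w(1,2,12) adj i j by simp
  qed
qed

section \<open>Assembling the flow\<close>

text \<open>Pairwise disjointness makes each part keep its own \<open>mate\<close> and
  \<open>endv\<close>, although \<open>munion\<close> gives priority to its left argument.\<close>

lemma foldr_munion:
  fixes F :: "nat \<Rightarrow> ('v, 'd) pole" and S :: "('v, 'd) multipole"
  assumes "distinct xs" "wf_multipole S" "\<And>i. i \<in> set xs \<Longrightarrow> wf_multipole (F i)"
    "\<And>i. i \<in> set xs \<Longrightarrow> disjoint_multipoles (F i) S"
    "\<And>i j. i \<in> set xs \<Longrightarrow> j \<in> set xs \<Longrightarrow> i \<noteq> j \<Longrightarrow> disjoint_multipoles (F i) (F j)"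
  shows "wf_multipole (foldr (\<lambda>i. munion (F i)) xs S) \<and>
    verts (foldr (\<lambda>i. munion (F i)) xs S) = (\<Union>i\<in>set xs. verts (F i)) \<union> verts S \<and>
    ends (foldr (\<lambda>i. munion (F i)) xs S) = (\<Union>i\<in>set xs. ends (F i)) \<union> ends S \<and>
    (\<forall>i\<in>set xs. \<forall>d\<in>ends (F i). mate (foldr (\<lambda>i. munion (F i)) xs S) d = mate (F i) d \<and>
      endv (foldr (\<lambda>i. munion (F i)) xs S) d = endv (F i) d) \<and>
    (\<forall>d\<in>ends S. mate (foldr (\<lambda>i. munion (F i)) xs S) d = mate S d \<and>
      endv (foldr (\<lambda>i. munion (F i)) xs S) d = endv S d)"
  using assms
proof (induction xs)
  case (Cons x xs)
  let ?N = "foldr (\<lambda>i. munion (F i)) xs S"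
  have IH: "wf_multipole ?N" "verts ?N = (\<Union>i\<in>set xs. verts (F i)) \<union> verts S"
    "ends ?N = (\<Union>i\<in>set xs. ends (F i)) \<union> ends S"
    "\<And>i d. i \<in> set xs \<Longrightarrow> d \<in> ends (F i) \<Longrightarrow> mate ?N d = mate (F i) d \<and> endv ?N d = endv (F i) d"
    "\<And>d. d \<in> ends S \<Longrightarrow> mate ?N d = mate S d \<and> endv ?N d = endv S d"
    using Cons.IH Cons.prems by simp_all
  have "x \<noteq> i" if "i \<in> set xs" for i using Cons.prems(1) that by auto
  then have dis: "disjoint_multipoles (F x) (F i)" if "i \<in> set xs" for i
    using Cons.prems(5)[of x i] that by simp
  have disN: "disjoint_multipoles (F x) ?N"
    using dis Cons.prems(4)[of x] unfolding disjoint_multipoles_def IH(2,3) by auto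
  note R = munion_right[OF disN]
  have "wf_multipole (munion (F x) ?N)"
    by (rule wf_munion[OF Cons.prems(3) IH(1) disN]) simp
  moreover have "mate (munion (F x) ?N) d = mate (F i) d \<and> endv (munion (F x) ?N) d = endv (F i) d"
    if "i \<in> set (x # xs)" "d \<in> ends (F i)" for i d
  proof (cases "i = x")
    case False
    then have "i \<in> set xs" using that by simp
    moreover have "d \<in> ends ?N" using that(2) calculation IH(3) by auto
    ultimately show ?thesis using R IH(4) that(2) by simp
  qed (use that in \<open>simp add: munion_left\<close>)
  moreover have "mate (munion (F x) ?N) d = mate S d \<and> endv (munion (F x) ?N) d = endv S d"
    if "d \<in> ends S" for d
  proof -
    have "d \<in> ends ?N" using that IH(3) by auto
    then show ?thesis using R IH(5) that by simp
  qed
  ultimately show ?case by (simp add: IH(2,3) Un_assoc)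
qed simp

lemma fold_attach:
  shows "verts (fold (\<lambda>i. attach (f i) (t i)) xs M) = verts M"
    "ends (fold (\<lambda>i. attach (f i) (t i)) xs M) = ends M"
    "mate (fold (\<lambda>i. attach (f i) (t i)) xs M) = mate M"
    "d \<notin> f ` set xs \<Longrightarrow> endv (fold (\<lambda>i. attach (f i) (t i)) xs M) d = endv M d"
    "distinct xs \<Longrightarrow> inj_on f (set xs) \<Longrightarrow> i \<in> set xs \<Longrightarrow>
      endv (fold (\<lambda>i. attach (f i) (t i)) xs M) (f i) = Some (t i)"
proof (induction xs arbitrary: M d i)
  case (Cons x xs)
  {
    case 5
    show ?case
    proof (cases "i = x")
      case True
      then have "f i \<notin> f ` set xs" using 5 by auto
      then show ?thesis using Cons.IH(4) True by (simp add: attach_def)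
    qed (use 5 Cons.IH(5) in auto)
  }
qed (simp_all add: attach_def)

lemma distinct_concat_map:
  assumes "distinct xs" "\<And>x. x \<in> set xs \<Longrightarrow> distinct (f x)"
    "\<And>x y. x \<in> set xs \<Longrightarrow> y \<in> set xs \<Longrightarrow> x \<noteq> y \<Longrightarrow> set (f x) \<inter> set (f y) = {}"
  shows "distinct (concat (map f xs))"
  using assms
proof (induction xs)
  case (Cons x xs)
  have "set (f x) \<inter> set (f y) = {}" if "y \<in> set xs" for y
    using Cons.prems(3)[of x y] Cons.prems(1) that by auto
  then have "set (f x) \<inter> (\<Union>y\<in>set xs. set (f y)) = {}" by blast
  moreover have "distinct (concat (map f xs))" using Cons by simp
  ultimately show ?case using Cons.prems(2)[of x] by simp
qed simp

section \<open>The inner tree of a Halin graph\<close>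

lemma delete_verts_simps [simp]:
  "verts (delete_verts M X) = verts M - X" "mate (delete_verts M X) = mate M"
  "endv (delete_verts M X) = endv M"
  "ends (delete_verts M X) = {d \<in> ends M. endv M d \<notin> Some ` X \<and> endv M (mate M d) \<notin> Some ` X}"
  by (simp_all add: delete_verts_def)

lemma wf_delete_verts:
  assumes "wf_multipole M"
  shows "wf_multipole (delete_verts M X)"
proof -
  note i = involutiveD[OF wf_imp_involutive[OF assms]]
  show ?thesis
    unfolding wf_multipole_def
  proof (intro conjI ballI)
    fix d assume "d \<in> ends (delete_verts M X)"
    then have d: "d \<in> ends M" "endv M d \<notin> Some ` X" "endv M (mate M d) \<notin> Some ` X" by simp_all
    show "mate (delete_verts M X) d \<in> ends (delete_verts M X)" "mate (delete_verts M X) d \<noteq> d"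
      "mate (delete_verts M X) (mate (delete_verts M X) d) = d"
      using d i[OF d(1)] by simp_all
    show "\<forall>v. endv (delete_verts M X) d = Some v \<longrightarrow> v \<in> verts (delete_verts M X)"
      using assms d by (auto simp: wf_multipole_def)
  qed (use assms in \<open>simp_all add: wf_multipole_def\<close>)
qed

text \<open>A leaf has a single tree edge, so its neighbour is unique; the neighbour is no leaf,
  because two adjacent leaves would make up the whole tree, which has a vertex of degree 3. Deleting
  the leaves takes from \<open>w\<close> exactly one end per adjacent leaf; these are the ends that
  residual semiedges replace in the Halin snark.\<close>

lemma halin_inner_tree:
  fixes H :: "('v, 'd) multipole"
  assumes H: "cubic_halin_graph H C"
  shows "wf_multipole (halin_inner_tree H C)"
    and "j < length C \<Longrightarrow> tree_neighbour H C j \<in> verts (halin_inner_tree H C)"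
    and "j < length C \<Longrightarrow> (cvert H C j, v) \<in> adj (halin_tree H C) \<Longrightarrow> tree_neighbour H C j = v"
    and "w \<in> verts H \<Longrightarrow> degree (halin_tree H C) w = 3 \<Longrightarrow> w \<in> verts (halin_inner_tree H C) \<and>
      card (ends_at (halin_inner_tree H C) w) + card {j. j < length C \<and> tree_neighbour H C j = w} = 3"
proof -
  let ?S = "halin_tree H C" and ?k = "length C" and ?v = "cvert H C"
  let ?X = "?v ` {..<?k}" and ?t = "tree_neighbour H C"
  have cub: "cubic_graph H" and C: "circuit H C" and conn: "connected_graph ?S"
    and inner: "\<exists>v\<in>verts ?S. degree ?S v = 3"
    and leaves: "?X = {v \<in> verts ?S. degree ?S v = 1}"
    using H by (auto simp: cubic_halin_graph_def Let_def tree_def)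
  have wfH: "wf_multipole H" and nosemi: "semiedges H = {}"
    using cub by (auto simp: cubic_graph_def cubic_multipole_def)
  have wfS: "wf_multipole ?S" using wf_halin_tree[OF wfH] C by (simp add: circuit_def)
  note i = involutiveD[OF wf_imp_involutive[OF wfS]]
  have S': "halin_inner_tree H C = delete_verts ?S ?X" by (simp add: halin_inner_tree_def)
  show "wf_multipole (halin_inner_tree H C)"
    unfolding S' by (rule wf_delete_verts[OF wfS])
  have vert: "\<exists>v. endv ?S d = Some v \<and> v \<in> verts ?S" if "d \<in> ends ?S" for d
    using cubic_graph_endv[OF cub, of d] that by auto
  have leaf: "degree ?S (?v j) = 1" "?v j \<in> verts ?S" if "j < ?k" for j
    using leaves that by auto
  define dd where "dd j = the_elem (ends_at ?S (?v j))" for j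
  have dd: "ends_at ?S (?v j) = {dd j}" if "j < ?k" for j
    using leaf(1)[OF that] unfolding degree_def dd_def by (metis card_1_singletonE the_elem_eq)
  have dS: "dd j \<in> ends ?S" "endv ?S (dd j) = Some (?v j)" if "j < ?k" for j
    using dd[OF that] by (auto simp: ends_at_def)
  have adj: "(?v j, u) \<in> adj ?S \<longleftrightarrow> endv ?S (mate ?S (dd j)) = Some u" if "j < ?k" for j u
  proof -
    have "d = dd j" if "d \<in> ends ?S" "endv ?S d = Some (?v j)" for d
      using dd[OF \<open>j < ?k\<close>] that by (auto simp: ends_at_def)
    then show ?thesis using dS[OF that] unfolding adj_def mem_Collect_eq prod.case by metis
  qed
  have t: "endv ?S (mate ?S (dd j)) = Some (?t j)" if j: "j < ?k" for j
  proof -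
    obtain u where u: "endv ?S (mate ?S (dd j)) = Some u" using vert[OF i(1)[OF dS(1)[OF j]]] by blast
    have "?t j = u"
      unfolding tree_neighbour_def using u by (intro the_equality) (auto simp only: adj[OF j] option.inject)
    then show ?thesis using u by simp
  qed
  show "?t j = u" if "j < ?k" "(?v j, u) \<in> adj ?S" for j u
    using t[OF that(1)] adj[OF that(1)] that(2) by simp
  have tX: "?t j \<notin> ?X" if j: "j < ?k" for j
  proof
    assume "?t j \<in> ?X"
    then have deg1: "degree ?S (?t j) = 1" using leaves by auto
    have mt: "mate ?S (dd j) \<in> ends_at ?S (?t j)"
      using t[OF j] i(1)[OF dS(1)[OF j]] by (simp add: ends_at_def)
    have "v \<in> {?v j, ?t j}" if "v \<in> verts ?S" for v
    proof (rule connected_closed_set[OF conn leaf(2)[OF j] that])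
      fix d s u assume d: "d \<in> ends ?S" "endv ?S d = Some s" "endv ?S (mate ?S d) = Some u" "s \<in> {?v j, ?t j}"
      then have dat: "d \<in> ends_at ?S s" by (simp add: ends_at_def)
      consider "s = ?v j" | "s = ?t j" using d(4) by blast
      then have "d = dd j \<or> d = mate ?S (dd j)"
        using dat dd[OF j] degree_1_unique[OF deg1 mt] by cases auto
      then show "u \<in> {?v j, ?t j}"
        using d(3) t[OF j] dS[OF j] i(3)[OF dS(1)[OF j]] by auto
    qed simp
    then show False using inner deg1 leaf(1)[OF j] by fastforce
  qed
  show "?t j \<in> verts (halin_inner_tree H C)" if j: "j < ?k"
    using vert[OF i(1)[OF dS(1)[OF j]]] t[OF j] tX[OF j] unfolding S' by simp
  show "w \<in> verts (halin_inner_tree H C) \<and> card (ends_at (halin_inner_tree H C) w) + card {j. j < ?k \<and> ?t j = w} = 3"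
    if w: "w \<in> verts H" "degree ?S w = 3"
  proof
    have wX: "w \<notin> ?X" using w leaves by auto
    then show "w \<in> verts (halin_inner_tree H C)" using w unfolding S' by simp
    let ?A = "ends_at ?S w" and ?L = "{d \<in> ends_at ?S w. endv ?S (mate ?S d) \<in> Some ` ?X}"
    have at: "ends_at (halin_inner_tree H C) w = ?A - ?L"
      using wX unfolding S' ends_at_def by auto
    \<comment> \<open>An end determines its mate and thereby the leaf, and the circuit visits each
      leaf only once.\<close>
    have inj: "inj_on (\<lambda>j. mate ?S (dd j)) {j. j < ?k \<and> ?t j = w}"
    proof (rule inj_onI)
      fix m n assume mn: "m \<in> {j. j < ?k \<and> ?t j = w}" "n \<in> {j. j < ?k \<and> ?t j = w}" "mate ?S (dd m) = mate ?S (dd n)"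
      then have "dd m = dd n" using i(3)[OF dS(1)] by (metis (no_types, lifting) mem_Collect_eq)
      then have "endv H (C ! m) = endv H (C ! n)"
        using dS(2)[of m] dS(2)[of n] mn cvert_Some[OF C] by simp
      moreover have "distinct (map (endv H) C)" using C by (simp add: circuit_def)
      ultimately show "m = n" using mn by (simp add: distinct_conv_nth) metis
    qed
    have L: "?L = (\<lambda>j. mate ?S (dd j)) ` {j. j < ?k \<and> ?t j = w}"
    proof (intro equalityI subsetI)
      fix d assume "d \<in> ?L"
      then obtain j where j: "j < ?k" "endv ?S (mate ?S d) = Some (?v j)" and d: "d \<in> ends ?S" "endv ?S d = Some w"
        by (auto simp: ends_at_def)
      have "mate ?S d \<in> ends_at ?S (?v j)" using j(2) i(1)[OF d(1)] unfolding ends_at_def by blast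
      then have "mate ?S d = dd j" using dd[OF j(1)] by blast
      then have "d = mate ?S (dd j)" using i(3)[OF d(1)] by simp
      moreover have "?t j = w" using t[OF j(1)] d(2) calculation by simp
      ultimately show "d \<in> (\<lambda>j. mate ?S (dd j)) ` {j. j < ?k \<and> ?t j = w}" using j(1) by blast
    next
      fix d assume "d \<in> (\<lambda>j. mate ?S (dd j)) ` {j. j < ?k \<and> ?t j = w}"
      then obtain j where j: "j < ?k" "?t j = w" "d = mate ?S (dd j)" by blast
      have "d \<in> ends ?S" "endv ?S d = Some w" "endv ?S (mate ?S d) = Some (?v j)"
        using t[OF j(1)] i[OF dS(1)[OF j(1)]] dS(2)[OF j(1)] j(2) unfolding j(3) by simp_all
      then show "d \<in> ?L" using j(1) unfolding ends_at_def by blast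
    qed
    have fin: "finite ?A" using wfS by (intro finite_ends_at) (simp add: wf_multipole_def)
    have "card (?A - ?L) + card ?L = card ?A"
      using fin by (metis (no_types, lifting) add.commute card_Diff_subset card_mono finite_subset le_add_diff_inverse mem_Collect_eq subsetI)
    moreover have "card ?L = card {j. j < ?k \<and> ?t j = w}" unfolding L by (rule card_image[OF inj])
    ultimately show "card (ends_at (halin_inner_tree H C) w) + card {j. j < ?k \<and> ?t j = w} = 3"
      using w(2) unfolding at degree_def by simp
  qed
qed

text \<open>For \<open>n = 0\<close> this is the lower bound on \<open>x\<close>; for other
  \<open>n\<close> it follows from the upper bound, as \<open>n * r\<close> is then at least
  \<open>r\<close> in absolute value.\<close>

lemma far_from_multiples:
  fixes x r :: real and n :: int
  assumes "1 \<le> \<bar>x\<bar>" "\<bar>x\<bar> \<le> r - 1"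
  shows "1 \<le> \<bar>x - n * r\<bar>"
proof -
  consider "n = 0" | "n \<ge> 1" | "n \<le> -1" by linarith
  then show ?thesis
  proof cases
    case 2
    then have "r \<le> n * r" using assms by (simp add: mult_le_cancel_right1)
    then show ?thesis using assms by linarith
  next
    case 3
    then have "n * r \<le> - r" using assms mult_right_mono[of "of_int n" "-1" r] by simp
    then show ?thesis using assms by linarith
  qed (use assms in simp)
qed

theorem theorem9p1:
  fixes p :: "4 \<Rightarrow> bit ^ 4"
    and H G :: "('v, 'd) multipole"
    and C :: "'d list"
    and D B F :: "nat \<Rightarrow> ('v, 'd) pole"
  assumes "basis_F2_4 p"
    and "halin_snark p H C D B F G"
    and "\<forall>i<length C. \<exists>G' d. snark G' \<and> 5 \<le> circular_flow_number G' \<and>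
           path1 G' d \<and> D i = remove_path1 G' d"
  shows "5 \<le> circular_flow_number G"
proof (rule ccontr)
  assume "\<not> 5 \<le> circular_flow_number G"
  \<comment> \<open>The infimum is below 5, so some flow has a parameter \<open>r\<close> strictly
    below 5; this \<open>r\<close> is fixed from here on.\<close>
  then obtain r where r: "2 \<le> r" "has_nowhere_zero_flow G r" "ereal r < 5"
    unfolding circular_flow_number_def not_le Inf_less_iff by blast
  define k where "k = length C"
  define S where "S = halin_inner_tree H C"
  define t where "t = tree_neighbour H C"
  define res where "res i = the_elem (resid (F i))" for i
  define s where "s i = Suc i mod k" for i
  obtain P where H: "cubic_halin_graph H C"
    and frag: "\<And>i. i < k \<Longrightarrow> halin_fragment p (D i) (B i) (F i)"
    and disS: "\<And>i. i < k \<Longrightarrow> disjoint_multipoles (F i) S"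
    and disF: "\<And>i j. i < k \<Longrightarrow> j < k \<Longrightarrow> i \<noteq> j \<Longrightarrow> disjoint_multipoles (F i) (F j)"
    and P: "\<And>i. i < k \<Longrightarrow> connector_matching (outp (F i)) (inp (F (s i))) (P i)"
    and G: "G = fold (\<lambda>i. attach (res i) (t i)) [0..<k]
        (junctions (concat (map P [0..<k])) (foldr (\<lambda>i. munion (F i)) [0..<k] S))"
    using assms(2) unfolding halin_snark_def Let_def k_def S_def t_def res_def s_def by blast
  define N where "N = foldr (\<lambda>i. munion (F i)) [0..<k] S"
  define ps where "ps = concat (map P [0..<k])"
  have G: "G = fold (\<lambda>i. attach (res i) (t i)) [0..<k] (junctions ps N)"
    using G by (simp add: N_def ps_def)
  note tree = halin_inner_tree[OF H, folded S_def t_def k_def]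

  have D: "pole_2_2 (D i)" and B: "pole_2_2_1 (B i)" and join: "is_join (D i) (B i) (F i)" if "i < k" for i
    using frag[OF that] bipartite_imp_pole_2_2_1
    by (auto simp: halin_fragment_def decollineator_def)
  have F: "pole_2_2_1 (F i)" and inpF: "inp (F i) = inp (D i)" if "i < k" for i
    using is_join_pole_2_2_1[OF D B join] that by auto
  have wfF: "wf_multipole (F i)"
    and semiF: "semiedges (F i) = inp (F i) \<union> outp (F i) \<union> resid (F i)"
    and sepF: "inp (F i) \<inter> outp (F i) = {}" "inp (F i) \<inter> resid (F i) = {}" "outp (F i) \<inter> resid (F i) = {}"
    and resF: "resid (F i) = {res i}" if "i < k" for i
    using F[OF that] unfolding pole_2_2_1_def res_def by (auto simp: card_1_singleton_iff)
  have free: "d \<in> ends (F i)" "endv (F i) d = None"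
    if "i < k" "d \<in> inp (F i) \<union> outp (F i) \<union> resid (F i)" for i d
    using semiF[OF that(1)] that(2) unfolding semiedges_def by blast+
  have endsF: "i = j" if "d \<in> ends (F i)" "d \<in> ends (F j)" "i < k" "j < k" for d i j
    using disF[of i j] that by (auto simp: disjoint_multipoles_def)
  have s: "s i < k" if "i < k" for i using that by (auto simp: s_def)
  have s_inj: "i = j" if "s i = s j" "i < k" "j < k" for i j
    using that by (auto simp: s_def mod_Suc split: if_splits)

  have N: "wf_multipole N" "verts N = (\<Union>i<k. verts (F i)) \<union> verts S"
    "ends N = (\<Union>i<k. ends (F i)) \<union> ends S"
    and N_F: "\<And>i d. i < k \<Longrightarrow> d \<in> ends (F i) \<Longrightarrow> mate N d = mate (F i) d \<and> endv N d = endv (F i) d"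
    and N_S: "\<And>d. d \<in> ends S \<Longrightarrow> endv N d = endv S d"
    using foldr_munion[of "[0..<k]" S F] tree(1) wfF disS disF
    unfolding N_def by (simp_all add: atLeast0LessThan)
  have P_sets: "fst ` set (P i) = outp (F i)" "snd ` set (P i) = inp (F (s i))" if "i < k" for i
    using connector_matching_sets[OF P[OF that]] .
  have ps_set: "q \<in> set ps \<longleftrightarrow> (\<exists>i<k. q \<in> set (P i))" for q
    by (auto simp: ps_def)
  have ps_fst: "\<exists>i<k. d \<in> outp (F i)" if "d \<in> fst ` set ps" for d
    using that ps_set P_sets by blast
  have ps_snd: "\<exists>i<k. d \<in> inp (F i)" if "d \<in> snd ` set ps" for d
    using that ps_set P_sets s by blast
  have ps_N: "fst ` set ps \<union> snd ` set ps \<subseteq> ends N"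
    using ps_fst ps_snd free(1) unfolding N(3) by blast
  \<comment> \<open>No end takes part in two junctions: different fragments are disjoint, the
    rotation \<open>s\<close> is injective, and input and output of one fragment are
    disjoint.\<close>
  have ps_distinct: "distinct (map fst ps @ map snd ps)"
  proof -
    have "distinct (concat (map (\<lambda>i. map fst (P i)) [0..<k]))"
    proof (rule distinct_concat_map)
      fix i j assume "i \<in> set [0..<k]" "j \<in> set [0..<k]" "i \<noteq> j"
      then have ij: "i < k" "j < k" "i \<noteq> j" by auto
      show "set (map fst (P i)) \<inter> set (map fst (P j)) = {}"
        using P_sets(1)[OF ij(1)] P_sets(1)[OF ij(2)] free(1)[OF ij(1)] free(1)[OF ij(2)] endsF[OF _ _ ij(1,2)] ij(3)
        unfolding set_map by blast
    qed (use P in \<open>simp_all add: connector_matching_def\<close>)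
    moreover have "distinct (concat (map (\<lambda>i. map snd (P i)) [0..<k]))"
    proof (rule distinct_concat_map)
      fix i j assume "i \<in> set [0..<k]" "j \<in> set [0..<k]" "i \<noteq> j"
      then have ij: "i < k" "j < k" "s i < k" "s j < k" "s i \<noteq> s j" using s s_inj by auto
      show "set (map snd (P i)) \<inter> set (map snd (P j)) = {}"
        using P_sets(2)[OF ij(1)] P_sets(2)[OF ij(2)] free(1)[OF ij(3)] free(1)[OF ij(4)] endsF[OF _ _ ij(3,4)] ij(5)
        unfolding set_map by blast
    qed (use P in \<open>simp_all add: connector_matching_def\<close>)
    moreover have "False" if d: "d \<in> fst ` set ps" "d \<in> snd ` set ps" for d
    proof -
      obtain i j where ij: "i < k" "d \<in> outp (F i)" "j < k" "d \<in> inp (F j)"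
        using ps_fst[OF d(1)] ps_snd[OF d(2)] by blast
      then have "i = j" using endsF[of d i j] free(1)[of i d] free(1)[of j d] by blast
      then show False using ij sepF(1)[OF ij(1)] by blast
    qed
    ultimately show ?thesis by (auto simp: ps_def map_concat o_def)
  qed
  have wfJ: "wf_multipole (junctions ps N)" by (rule wf_junctions[OF N(1) ps_distinct ps_N])
  have resE: "res i \<in> ends (F i)" "endv (F i) (res i) = None" if "i < k" for i
    using free[OF that, of "res i"] resF[OF that] by auto
  have res_inj: "inj_on res {..<k}"
    using resE(1) endsF by (intro inj_onI) (metis lessThan_iff)

  have G': "ends G = ends N - fst ` set ps - snd ` set ps" "mate G = mate (junctions ps N)" "verts G = verts N"
    unfolding G by (simp_all add: fold_attach)
  have G_res: "endv G (res i) = Some (t i)" if "i < k" for i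
    unfolding G by (rule fold_attach(5)) (use that res_inj in \<open>auto simp: atLeast0LessThan\<close>)
  have G_other: "endv G d = endv N d" if "d \<notin> res ` {..<k}" for d
    unfolding G by (subst fold_attach(4)) (use that in \<open>auto simp: atLeast0LessThan\<close>)
  have res_G: "res i \<in> ends G" if i: "i < k" for i
  proof -
    have "False" if d: "res i \<in> fst ` set ps \<union> snd ` set ps"
    proof -
      obtain j where j: "j < k" "res i \<in> outp (F j) \<union> inp (F j)"
        using d ps_fst ps_snd by blast
      then have "i = j" using endsF[of "res i" i j] free(1)[of j "res i"] resE(1)[OF i] i by blast
      then show False using j sepF[OF i] resF[OF i] by blast
    qed
    then show ?thesis using resE(1)[OF i] i unfolding G'(1) N(3) by blast
  qed
  \<comment> \<open>Junctions remove only free ends, and attachments lead to vertices of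
    \<open>S\<close>, so nothing changes at the vertices of a fragment.\<close>
  have at_F: "ends_at G v = ends_at (F i) v" if i: "i < k" and v: "v \<in> verts (F i)" for i v
  proof (intro equalityI subsetI)
    fix d assume "d \<in> ends_at G v"
    then have d: "d \<in> ends N" "endv G d = Some v" by (auto simp: ends_at_def G'(1))
    have vS: "v \<notin> verts S" using disS[OF i] v by (auto simp: disjoint_multipoles_def)
    have "d \<notin> res ` {..<k}" using G_res tree(2) d(2) vS by fastforce
    then have dv: "endv N d = Some v" using G_other d(2) by simp
    have "d \<notin> ends S" using N_S[of d] dv vS tree(1) by (auto simp: wf_multipole_def)
    then obtain j where j: "j < k" "d \<in> ends (F j)" using d(1) N(3) by blast
    then have "endv (F j) d = Some v" "v \<in> verts (F j)"
      using N_F[OF j] dv wfF[OF j(1)] by (auto simp: wf_multipole_def)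
    moreover have "j = i"
    proof (rule ccontr)
      assume "j \<noteq> i"
      then show False using disF[OF j(1) i] calculation(2) v by (auto simp: disjoint_multipoles_def)
    qed
    ultimately show "d \<in> ends_at (F i) v" using j by (simp add: ends_at_def)
  next
    fix d assume "d \<in> ends_at (F i) v"
    then have d: "d \<in> ends (F i)" "endv (F i) d = Some v" by (auto simp: ends_at_def)
    have same: "j = i" if "j < k" "d \<in> inp (F j) \<union> outp (F j) \<union> resid (F j)" for j
      using endsF[of d j i] free(1)[OF that] d i that by blast
    then have nf: "d \<notin> inp (F j) \<union> outp (F j) \<union> resid (F j)" if "j < k" for j
      using free(2)[of j d] d(2) that by force
    have "d \<notin> res ` {..<k}" using nf resF by blast
    moreover have "d \<notin> fst ` set ps \<union> snd ` set ps" using nf ps_fst ps_snd by blast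
    moreover have "d \<in> ends N" using d(1) i N(3) by blast
    ultimately show "d \<in> ends_at G v"
      using G_other[of d] N_F[OF i d(1)] d(2) by (simp add: ends_at_def G'(1))
  qed
  have at_S: "ends_at G w = ends_at S w \<union> res ` {j. j < k \<and> t j = w}" if w: "w \<in> verts S" for w
  proof (intro equalityI subsetI)
    fix d assume "d \<in> ends_at G w"
    then have d: "d \<in> ends N" "endv G d = Some w" by (auto simp: ends_at_def G'(1))
    show "d \<in> ends_at S w \<union> res ` {j. j < k \<and> t j = w}"
    proof (cases "d \<in> res ` {..<k}")
      case True
      then show ?thesis using G_res d(2) by auto
    next
      case False
      then have dv: "endv N d = Some w" using G_other d(2) by simp
      have "d \<notin> ends (F j)" if j: "j < k" for j
      proof
        assume dF: "d \<in> ends (F j)"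
        then have "endv (F j) d = Some w" using N_F[OF j dF] dv by simp
        then have "w \<in> verts (F j)" using wfF[OF j] dF by (simp add: wf_multipole_def)
        then show False using w disS[OF j] by (auto simp: disjoint_multipoles_def)
      qed
      then have "d \<in> ends S" using d(1) N(3) by blast
      then show ?thesis using N_S dv by (simp add: ends_at_def)
    qed
  next
    fix d assume "d \<in> ends_at S w \<union> res ` {j. j < k \<and> t j = w}"
    then show "d \<in> ends_at G w"
    proof
      assume "d \<in> ends_at S w"
      then have d: "d \<in> ends S" "endv S d = Some w" by (auto simp: ends_at_def)
      have nF: "d \<notin> ends (F j)" if "j < k" for j
        using disS[OF that] d(1) by (auto simp: disjoint_multipoles_def)
      then have "d \<notin> res ` {..<k}" using resE(1) by blast
      moreover have "d \<notin> fst ` set ps \<union> snd ` set ps" using nF free(1) ps_fst ps_snd by blast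
      ultimately show ?thesis
        using G_other[of d] N_S[OF d(1)] d N(3) by (simp add: ends_at_def G'(1))
    next
      assume "d \<in> res ` {j. j < k \<and> t j = w}"
      then show ?thesis using G_res res_G by (auto simp: ends_at_def)
    qed
  qed

  have wfG: "involutive G" "finite (ends G)"
    using wf_imp_involutive[OF wfJ] wfJ unfolding involutive_def wf_multipole_def by (simp_all add: G')
  obtain g where g: "end_flow G r g" by (rule has_flow_imp_end_flow[OF wfG r(2)])
  then have "nz_skew (junctions ps N) r g"
    by (simp add: end_flow_def nz_skew_def skew_def G')
  \<comment> \<open>\<open>h\<close> agrees with \<open>g\<close> on \<open>G\<close> and gives
    meaningful values to the ends that the junctions removed, so that sums over connectors can be
    used.\<close>
  then obtain h where h: "nz_skew N r h" "\<forall>d\<in>ends (junctions ps N). h d = g d"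
    "\<forall>q\<in>set ps. h (snd q) = - h (fst q)"
    using nz_skew_junctions[OF wf_imp_involutive[OF N(1)] ps_distinct ps_N _ r(1)] by blast
  have hg: "h d = g d" if "d \<in> ends G" for d using h(2) that by (simp add: G')
  have out: "(\<Sum>d\<in>ends_at G v. h d) = 0" if "v \<in> verts G" for v
  proof -
    have "(\<Sum>d\<in>ends_at G v. h d) = (\<Sum>d\<in>ends_at G v. g d)"
      by (rule sum.cong) (auto simp: ends_at_def hg)
    then show ?thesis using g that by (simp add: end_flow_def outflow_def)
  qed
  have bound: "1 \<le> \<bar>h d\<bar>" "\<bar>h d\<bar> \<le> r - 1" if "d \<in> ends N" for d
    using h(1) that by (auto simp: nz_skew_def)
  have flowF: "end_flow (F i) r h" if i: "i < k" for i
  proof -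
    have "h (mate (F i) d) = - h d" if d: "d \<in> ends (F i)" for d
    proof -
      have "d \<in> ends N" using d i N(3) by blast
      then have "h (mate N d) = - h d" using h(1) by (simp add: nz_skew_def skew_def)
      then show ?thesis using N_F[OF i d] by simp
    qed
    moreover have "outflow (F i) h v = 0" if v: "v \<in> verts (F i)" for v
      unfolding outflow_def at_F[OF i v, symmetric] by (rule out) (use v i in \<open>auto simp: G' N(2)\<close>)
    moreover have "1 \<le> \<bar>h d\<bar> \<and> \<bar>h d\<bar> \<le> r - 1" if "d \<in> ends (F i)" for d
      using bound[of d] that i N(3) by blast
    ultimately show ?thesis unfolding end_flow_def nz_skew_def skew_def by blast
  qed
  define f where "f i = (\<Sum>d\<in>inp (F i). h d)" for i
  have near: "\<exists>n::int. \<bar>f i - n * r\<bar> < 1" if i: "i < k" for i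
  proof -
    obtain G' d where G': "snark G'" "5 \<le> circular_flow_number G'" "path1 G' d" "D i = remove_path1 G' d"
      using assms(3) i unfolding k_def by blast
    \<comment> \<open>A flow with this \<open>r\<close> would bring the circular flow number of
      \<open>G'\<close> down to at most \<open>r\<close>, below 5.\<close>
    have no: "\<not> has_nowhere_zero_flow G' r"
    proof
      assume "has_nowhere_zero_flow G' r"
      then have "circular_flow_number G' \<le> ereal r"
        unfolding circular_flow_number_def using r(1) by (intro Inf_lower) blast
      then show False using G'(2) r(3) by (meson leD order_trans)
    qed
    obtain h' where h': "end_flow (D i) r h'" "\<And>d. d \<in> inp (D i) \<Longrightarrow> h' d = h d"
      using is_join_flow[OF D[OF i] B[OF i] join[OF i] flowF[OF i] r(1)] by blast
    have "(\<Sum>d\<in>inp (D i). h' d) = f i"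
      unfolding f_def inpF[OF i] by (rule sum.cong) (simp_all add: h'(2))
    then show ?thesis
      using remove_path1_flow[OF _ G'(3,4) D[OF i] h'(1) r(1) no] G'(1) by (simp add: snark_def)
  qed
  \<comment> \<open>In a fragment the two connector totals and the residual value sum to 0, and the
    output total reappears negated at the next input.\<close>
  have h_res: "h (res i) = f (s i) - f i" if i: "i < k" for i
  proof -
    have "f i + (\<Sum>d\<in>outp (F i). h d) + h (res i) = 0"
      using pole_2_2_1_sum[OF F[OF i] flowF[OF i]] by (simp add: f_def res_def)
    moreover have "f (s i) = - (\<Sum>d\<in>outp (F i). h d)"
      unfolding f_def by (rule connector_matching_sum[OF P[OF i]]) (use h(3) ps_set i in blast)
    ultimately show ?thesis by simp
  qed

  obtain w i where w: "w \<in> verts H" "degree (halin_tree H C) w = 3" and i: "i < k"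
    and ne: "cvert H C i \<noteq> cvert H C (s i)"
    and adj: "(cvert H C i, w) \<in> adj (halin_tree H C)" "(cvert H C (s i), w) \<in> adj (halin_tree H C)"
    by (rule halin_consecutive_cherry[OF H]) (auto simp: k_def s_def)
  note si = s[OF i]
  have ti: "t i = w" "t (s i) = w" using tree(3)[OF i adj(1)] tree(3)[OF si adj(2)] by auto
  have wS: "w \<in> verts S" and card3: "card (ends_at S w) + card {j. j < k \<and> t j = w} = 3"
    using tree(4)[OF w] by auto
  \<comment> \<open>The two leaves are different, so the indices \<open>i\<close> and
    \<open>s i\<close> are, and with them the residual ends.\<close>
  have "res i \<noteq> res (s i)"
  proof
    assume "res i = res (s i)"
    then have "i = s i" by (rule inj_onD[OF res_inj]) (use i si in auto)
    then show False using ne by simp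
  qed
  have fin: "finite (ends_at S w)" using tree(1) by (intro finite_ends_at) (simp add: wf_multipole_def)
  have "ends_at S w \<inter> res ` {j. j < k \<and> t j = w} = {}"
    using resE(1) disS by (auto simp: ends_at_def disjoint_multipoles_def)
  then have "card (ends_at G w) = card (ends_at S w) + card (res ` {j. j < k \<and> t j = w})"
    unfolding at_S[OF wS] using fin by (intro card_Un_disjoint) auto
  also have "card (res ` {j. j < k \<and> t j = w}) = card {j. j < k \<and> t j = w}"
    by (rule card_image) (use res_inj in \<open>auto simp: inj_on_def\<close>)
  finally have "degree G w = 3" using card3 by (simp add: degree_def)
  \<comment> \<open>\<open>e\<close> may be an end of the inner tree or a further residual end; in
    both cases conservation at \<open>w\<close> determines its value.\<close>
  then obtain e where e: "e \<in> ends_at G w" "e \<noteq> res i" "e \<noteq> res (s i)" by (rule degree_3_third)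
  have sub: "{res i, res (s i), e} \<subseteq> ends_at G w" using e at_S[OF wS] ti i si by auto
  have three: "ends_at G w = {res i, res (s i), e}"
  proof (rule sym, rule card_subset_eq[OF _ sub])
    show "finite (ends_at G w)" using wfG(2) by (rule finite_ends_at)
    show "card {res i, res (s i), e} = card (ends_at G w)"
      using e \<open>res i \<noteq> res (s i)\<close> \<open>degree G w = 3\<close> by (simp add: degree_def)
  qed
  have "h (res i) + h (res (s i)) + h e = 0"
    using out[of w] wS e \<open>res i \<noteq> res (s i)\<close> unfolding three by (simp add: G'(3) N(2))
  \<comment> \<open>The differences telescope, so the third value is again a difference of two
    totals.\<close>
  then have he: "h e = f i - f (s (s i))" using h_res[OF i] h_res[OF si] by simp
  have inN: "res i \<in> ends N" "res (s i) \<in> ends N" "e \<in> ends N"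
    using sub by (auto simp: ends_at_def G'(1))
  have far: "1 \<le> \<bar>h d - real_of_int n * r\<bar>" if "d \<in> ends N" for d n
    using bound[OF that] by (rule far_from_multiples)
  obtain l m n :: int where lmn: "\<bar>f (s i) - l * r\<bar> < 1" "\<bar>f i - m * r\<bar> < 1" "\<bar>f (s (s i)) - n * r\<bar> < 1"
    using near[OF si] near[OF i] near[OF s[OF si]] by blast
  show False
    by (rule three_differences[OF _ _ _ lmn])
      (use far[OF inN(1)] far[OF inN(2)] far[OF inN(3)] in
        \<open>simp_all add: h_res[OF i] h_res[OF si] he\<close>)
qed

end
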